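(* Let $0<\kappa<K<\infty$ and $0<M<\infty$ be constants, and let $\mathcal{X}$ be the collection of functions $\sigma:[0,1]\to[\kappa,K]$ that are Lipschitz with Lipschitz constant $M$. Let $\Pi$ be a prior (probability measure) on $\mathcal{X}$ such that $$\Pi\left(\{\sigma'\in\mathcal{X}:\|\sigma'-\sigma\|_\infty<\varepsilon\}\right)>0\quad\text{for every }\varepsilon>0\text{ and every }\sigma\in\mathcal{X}.$$ Then posterior consistency holds: for every fixed $\sigma_0\in\mathcal{X}$ and every measurable neighbourhood $U_{\sigma_0}\subset\mathcal{X}$ of $\sigma_0$ in the topology on $\mathcal{X}$ induced by the $L_2([0,1])$-norm $\|\cdot\|_2$, if $X_t=\int_0^t\sigma_0(s)\,dW_s$, $t\in[0,1]$, is observed at the times $t_{i,n}=i/n$, $i=0,\ldots,n$, then $$\Pi\left(U_{\sigma_0}^c\,\middle|\,X_{t_{0,n}},\ldots,X_{t_{n,n}}\right)\longrightarrow 0\quad\text{in }\mathbb{P}_{\sigma_0}\text{-probability as }n\to\infty,$$ where $U_{\sigma_0}^c=\mathcal{X}\setminus U_{\sigma_0}$.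
   Context: For $\sigma\in\mathcal{X}$, $\mathbb{P}_\sigma$ denotes the law of the process $X_t=\int_0^t\sigma(s)\,dW_s$, $t\in[0,1]$ (so $X_0=0$), where $W$ is a standard Brownian motion and the integral is the Wiener integral. $\|\cdot\|_\infty$ is the supremum norm on $[0,1]$. The space $\mathcal{X}$ carries its Borel $\sigma$-algebra. The likelihood of the observations at $\sigma\in\mathcal{X}$ is $$L_n(\sigma)=\prod_{i=1}^{n}\left\{\frac{1}{\sqrt{2\pi\int_{t_{i-1,n}}^{t_{i,n}}\sigma^2(u)\,du}}\;\psi\left(\frac{X_{t_{i,n}}-X_{t_{i-1,n}}}{\sqrt{\int_{t_{i-1,n}}^{t_{i,n}}\sigma^2(u)\,du}}\right)\right\},\qquad \psi(u)=\exp(-u^2/2).$$ The posterior measure of a measurable set $\Sigma\subset\mathcal{X}$ is defined by $$\Pi(\Sigma\mid X_{t_{0,n}},\ldots,X_{t_{n,n}})=\frac{\int_\Sigma L_n(\sigma)\,\Pi(d\sigma)}{\int_{\mathcal{X}}L_n(\sigma)\,\Pi(d\sigma)}.$$ *)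

theory Defs
  imports "HOL-Probability.Probability"
begin

text \<open>Only times in \<open>[0,1]\<close> are used, so Brownian motion is only required on \<open>[0,1]\<close>; the
  restriction of a Brownian motion on \<open>[0,\<infinity>)\<close> is an instance. The variance of an increment over
  \<open>[s,t]\<close> is \<open>t - s\<close>; \<open>normal_density\<close> takes the standard deviation.\<close>

definition standard_brownian_motion :: "'w measure \<Rightarrow> (real \<Rightarrow> 'w \<Rightarrow> real) \<Rightarrow> bool" where
  "standard_brownian_motion M W \<longleftrightarrow>
     prob_space M \<and>
     (\<forall>t\<in>{0..1}. W t \<in> borel_measurable M) \<and>
     (AE \<omega> in M. W 0 \<omega> = 0) \<and>
     (\<forall>s\<in>{0..1}. \<forall>t\<in>{0..1}. s < t \<longrightarrow>
        distributed M lborel (\<lambda>\<omega>. W t \<omega> - W s \<omega>) (\<lambda>x. ennreal (normal_density 0 (sqrt (t - s)) x))) \<and>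
     (\<forall>n (p :: nat \<Rightarrow> real). (\<forall>i\<le>n. p i \<in> {0..1}) \<longrightarrow> (\<forall>i<n. p i \<le> p (Suc i)) \<longrightarrow>
        prob_space.indep_vars M (\<lambda>_. borel) (\<lambda>i \<omega>. W (p (Suc i)) \<omega> - W (p i) \<omega>) {..<n}) \<and>
     (AE \<omega> in M. continuous_on {0..1} (\<lambda>t. W t \<omega>))"

definition is_partition :: "real \<Rightarrow> real \<Rightarrow> nat \<Rightarrow> (nat \<Rightarrow> real) \<Rightarrow> bool" where
  "is_partition a b n p \<longleftrightarrow> p 0 = a \<and> p n = b \<and> (\<forall>i<n. p i \<le> p (Suc i))"

definition step_fun :: "nat \<Rightarrow> (nat \<Rightarrow> real) \<Rightarrow> (nat \<Rightarrow> real) \<Rightarrow> real \<Rightarrow> real" where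
  "step_fun n p c s = (\<Sum>i<n. c i * indicator {p i<..p (Suc i)} s)"

definition step_integral ::
  "(real \<Rightarrow> 'w \<Rightarrow> real) \<Rightarrow> nat \<Rightarrow> (nat \<Rightarrow> real) \<Rightarrow> (nat \<Rightarrow> real) \<Rightarrow> 'w \<Rightarrow> real" where
  "step_integral W n p c \<omega> = (\<Sum>i<n. c i * (W (p (Suc i)) \<omega> - W (p i) \<omega>))"

text \<open>The random variable \<open>Y\<close> is a version of the Wiener integral of \<open>f\<close> over \<open>[0,t]\<close>: an \<open>L\<^sup>2\<close> limit
  of the integrals of step functions that converge to \<open>f\<close> in \<open>L\<^sup>2([0,t])\<close>. By the isometry,
  \<open>Y\<close> is determined almost surely and the choice of the step functions does not matter.\<close>

definition has_wiener_integral ::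
  "'w measure \<Rightarrow> (real \<Rightarrow> 'w \<Rightarrow> real) \<Rightarrow> (real \<Rightarrow> real) \<Rightarrow> real \<Rightarrow> ('w \<Rightarrow> real) \<Rightarrow> bool" where
  "has_wiener_integral M W f t Y \<longleftrightarrow>
     set_borel_measurable lborel {0..t} f \<and>
     Y \<in> borel_measurable M \<and>
     (\<exists>N p c. (\<forall>k. is_partition 0 t (N k) (p k)) \<and>
        (\<lambda>k. \<integral>\<^sup>+s\<in>{0..t}. ennreal ((f s - step_fun (N k) (p k) (c k) s)\<^sup>2) \<partial>lborel) \<longlonglongrightarrow> 0 \<and>
        (\<lambda>k. \<integral>\<^sup>+\<omega>. ennreal ((Y \<omega> - step_integral W (N k) (p k) (c k) \<omega>)\<^sup>2) \<partial>M) \<longlonglongrightarrow> 0)"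

definition path_law :: "'w measure \<Rightarrow> (real \<Rightarrow> 'w \<Rightarrow> real) \<Rightarrow> (real \<Rightarrow> real) measure" where
  "path_law M X = distr M (Pi\<^sub>M {0..1} (\<lambda>_. borel)) (\<lambda>\<omega>. \<lambda>t\<in>{0..1}. X t \<omega>)"

definition converges_in_probability ::
  "'w measure \<Rightarrow> (nat \<Rightarrow> 'w \<Rightarrow> real) \<Rightarrow> ('w \<Rightarrow> real) \<Rightarrow> bool" where
  "converges_in_probability P Y Z \<longleftrightarrow>
     (\<forall>n. Y n \<in> borel_measurable P) \<and> Z \<in> borel_measurable P \<and>
     (\<forall>\<epsilon>>0. (\<lambda>n. measure P {\<omega>\<in>space P. \<bar>Y n \<omega> - Z \<omega>\<bar> > \<epsilon>}) \<longlonglongrightarrow> 0)"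

text \<open>A function on \<open>[0,1]\<close> is an extensional function (\<open>undefined\<close> outside \<open>[0,1]\<close>), so that
  equality of elements is equality on \<open>[0,1]\<close>.\<close>

definition lipschitz_class :: "real \<Rightarrow> real \<Rightarrow> real \<Rightarrow> (real \<Rightarrow> real) set" where
  "lipschitz_class \<kappa> K M = {\<sigma> \<in> {0..1} \<rightarrow>\<^sub>E {\<kappa>..K}. M-lipschitz_on {0..1} \<sigma>}"

definition sup_norm :: "(real \<Rightarrow> real) \<Rightarrow> real" where
  "sup_norm f = (SUP t\<in>{0..1}. \<bar>f t\<bar>)"

definition L2_norm :: "(real \<Rightarrow> real) \<Rightarrow> real" where
  "L2_norm f = sqrt (LINT t:{0..1}|lborel. (f t)\<^sup>2)"

text \<open>The topology on \<open>S\<close> induced by a norm \<open>N\<close>: a set is open iff it contains, around each of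
  its points, the trace on \<open>S\<close> of some ball. The norms are meaningful only for bounded,
  respectively square-integrable functions, so this is not phrased as a \<open>Metric_space\<close> topology,
  whose distance must be nonnegative on the whole type.\<close>

definition norm_topology ::
  "(real \<Rightarrow> real) set \<Rightarrow> ((real \<Rightarrow> real) \<Rightarrow> real) \<Rightarrow> (real \<Rightarrow> real) topology" where
  "norm_topology S N = topology (\<lambda>U. U \<subseteq> S \<and>
     (\<forall>\<sigma>\<in>U. \<exists>\<epsilon>>0. {\<sigma>'\<in>S. N (\<lambda>t. \<sigma>' t - \<sigma> t) < \<epsilon>} \<subseteq> U))"

lemma openin_norm_topology:
  "openin (norm_topology S N) U \<longleftrightarrow>
     U \<subseteq> S \<and> (\<forall>\<sigma>\<in>U. \<exists>\<epsilon>>0. {\<sigma>'\<in>S. N (\<lambda>t. \<sigma>' t - \<sigma> t) < \<epsilon>} \<subseteq> U)"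
proof -
  define B where "B \<sigma> \<epsilon> = {\<sigma>'\<in>S. N (\<lambda>t. \<sigma>' t - \<sigma> t) < \<epsilon>}" for \<sigma> and \<epsilon> :: real
  define P where "P U \<longleftrightarrow> U \<subseteq> S \<and> (\<forall>\<sigma>\<in>U. \<exists>\<epsilon>>0. B \<sigma> \<epsilon> \<subseteq> U)" for U
  have P_Int: "P (U \<inter> V)" if U: "P U" and V: "P V" for U V
    unfolding P_def
  proof (intro conjI ballI)
    show "U \<inter> V \<subseteq> S" using U by (auto simp: P_def)
    fix \<sigma> assume *: "\<sigma> \<in> U \<inter> V"
    obtain d where d: "d > 0" "B \<sigma> d \<subseteq> U" using U * unfolding P_def by blast
    obtain e where e: "e > 0" "B \<sigma> e \<subseteq> V" using V * unfolding P_def by blast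
    have "B \<sigma> (min d e) \<subseteq> B \<sigma> d \<inter> B \<sigma> e" by (auto simp: B_def)
    then show "\<exists>\<epsilon>>0. B \<sigma> \<epsilon> \<subseteq> U \<inter> V"
      using d e by (intro exI[of _ "min d e"]) auto
  qed
  have P_Union: "P (\<Union>\<U>)" if *: "\<And>U. U \<in> \<U> \<Longrightarrow> P U" for \<U>
    unfolding P_def
  proof (intro conjI ballI)
    show "\<Union>\<U> \<subseteq> S" using * by (auto simp: P_def)
    fix \<sigma> assume "\<sigma> \<in> \<Union>\<U>"
    then obtain U where U: "U \<in> \<U>" "\<sigma> \<in> U" by blast
    then obtain e where "e > 0" "B \<sigma> e \<subseteq> U"
      using *[OF U(1)] unfolding P_def by blast
    then show "\<exists>\<epsilon>>0. B \<sigma> \<epsilon> \<subseteq> \<Union>\<U>"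
      using U by (intro exI[of _ e]) auto
  qed
  have "istopology P"
    unfolding istopology_def using P_Int P_Union by simp
  then have "openin (topology P) U \<longleftrightarrow> P U"
    by (simp add: topology_inverse')
  then show ?thesis
    by (simp add: norm_topology_def P_def[abs_def] B_def)
qed

lemma topspace_norm_topology [simp]: "topspace (norm_topology S N) = S"
proof
  show "topspace (norm_topology S N) \<subseteq> S"
    using openin_norm_topology openin_topspace by blast
  have "openin (norm_topology S N) S"
    unfolding openin_norm_topology by (auto intro: exI[of _ 1])
  then show "S \<subseteq> topspace (norm_topology S N)"
    by (rule openin_subset)
qed

definition borel_of_topology :: "'a topology \<Rightarrow> 'a measure" where
  "borel_of_topology T = sigma (topspace T) {U. openin T U}"

text \<open>The \<open>\<sigma>\<close>-algebra is the one of the supremum norm. The two norms induce the same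
  topology on \<open>lipschitz_class\<close>, which is compact in the supremum norm.\<close>

definition lipschitz_borel :: "real \<Rightarrow> real \<Rightarrow> real \<Rightarrow> (real \<Rightarrow> real) measure" where
  "lipschitz_borel \<kappa> K M = borel_of_topology (norm_topology (lipschitz_class \<kappa> K M) sup_norm)"

text \<open>The observations are given by \<open>x :: nat \<Rightarrow> real\<close>, where \<open>x i\<close> is the value observed at
  time \<open>i / n\<close>.\<close>

definition obs_time :: "nat \<Rightarrow> nat \<Rightarrow> real" where
  "obs_time n i = real i / real n"

definition \<psi> :: "real \<Rightarrow> real" where
  "\<psi> u = exp (- (u\<^sup>2) / 2)"

definition increment_variance :: "nat \<Rightarrow> (real \<Rightarrow> real) \<Rightarrow> nat \<Rightarrow> real" where
  "increment_variance n \<sigma> i = (LINT u:{obs_time n (i - 1)..obs_time n i}|lborel. (\<sigma> u)\<^sup>2)"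

definition likelihood :: "nat \<Rightarrow> (nat \<Rightarrow> real) \<Rightarrow> (real \<Rightarrow> real) \<Rightarrow> real" where
  "likelihood n x \<sigma> = (\<Prod>i=1..n.
     1 / sqrt (2 * pi * increment_variance n \<sigma> i) *
     \<psi> ((x i - x (i - 1)) / sqrt (increment_variance n \<sigma> i)))"

definition posterior ::
  "(real \<Rightarrow> real) measure \<Rightarrow> nat \<Rightarrow> (nat \<Rightarrow> real) \<Rightarrow> (real \<Rightarrow> real) set \<Rightarrow> real" where
  "posterior prior n x A =
     (LINT \<sigma>:A|prior. likelihood n x \<sigma>) / (LINT \<sigma>|prior. likelihood n x \<sigma>)"

end

(* With v_i and w_i the integrals of sigma_0^2 and sigma^2 over the i-th interval, r_i = v_i / w_i and
   u_i = (X_{t_i} - X_{t_{i-1}})^2 / v_i - 1, the log likelihood ratio of sigma to sigma_0 is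
     - 1/2 sum_i (r_i - 1 - ln r_i) - 1/2 sum_i u_i (r_i - 1).
   The first sum is at least n a - b when sigma is L2-far from sigma_0, and at most a small multiple
   of n when sigma is uniformly close to it. Since sigma is Lipschitz, r_i varies by O(1/n) from one
   index to the next, so summation by parts bounds the second sum uniformly in sigma by the partial
   sums of the u_i alone; no entropy argument is needed. The u_i are centred and uncorrelated with
   variance 2, hence their partial sums are O(sqrt n) in mean and the second sum is o(n). The
   numerator of the posterior is then exponentially smaller than its denominator.
   Only second moments of the u_i are needed: these follow from the Gaussian law of every linear
   combination of two increments, which is an L2 limit of Gaussian step integrals. *)
theory Submission
  imports Defs "HOL-Real_Asymp.Real_Asymp"
begin

section \<open>Gaussian moments of Wiener integrals\<close>

text \<open>The hypothesis describes each \<open>X t\<close> separately, as an L2 limit along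
  partitions of its own, so nothing is given about two increments jointly. Linear combinations are
  therefore formed before the limit, of integrands and random variables at once. What passes to the
  limit is the characteristic function: L2 convergence alone would not carry fourth moments, which
  are read off the limiting Gaussian law instead. The Lipschitz condition is used twice: it makes
  the averages of \<sigma>^2 over the observation intervals retain the L2 distance up to O(1/n), and
  it bounds the steps in the summation by parts. The prior is used on a sup-norm ball because there
  all variance ratios are close to 1 simultaneously.\<close>

lemma char_distr_mult:
  fixes Y :: "'w \<Rightarrow> real"
  assumes [measurable]: "Y \<in> borel_measurable M"
  shows "char (distr M borel (\<lambda>\<omega>. c * Y \<omega>)) t = char (distr M borel Y) (c * t)"
  by (simp add: char_def integral_distr ac_simps)

text \<open>By Levy's uniqueness theorem \<open>Y\<close> has the law of \<open>sqrt v\<close> times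
  a standard normal variable. Assuming a characteristic function instead of a density keeps the
  degenerate case \<open>v = 0\<close>.\<close>

lemma (in prob_space) gaussian_moments:
  fixes Y :: "'a \<Rightarrow> real"
  assumes Y[measurable]: "Y \<in> borel_measurable M" and "0 \<le> v"
    and char: "\<And>t. char (distr M borel Y) t = complex_of_real (exp (- (v * t\<^sup>2) / 2))"
  shows "integrable M (\<lambda>\<omega>. (Y \<omega>)^2)" "expectation (\<lambda>\<omega>. (Y \<omega>)^2) = v"
    "integrable M (\<lambda>\<omega>. (Y \<omega>)^4)" "expectation (\<lambda>\<omega>. (Y \<omega>)^4) = 3 * v\<^sup>2"
proof -
  define N where "N = distr std_normal_distribution borel (\<lambda>z. sqrt v * z)"
  interpret S: real_distribution std_normal_distribution by (rule real_dist_normal_dist)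
  have meas[measurable]: "(\<lambda>z. c * z) \<in> borel_measurable std_normal_distribution" for c :: real by simp
  have charN: "char N t = complex_of_real (exp (- (v * t\<^sup>2) / 2))" for t
  proof -
    have "char N t = char (distr std_normal_distribution borel (\<lambda>z. z)) (sqrt v * t)"
      unfolding N_def by (rule char_distr_mult) simp
    also have "distr std_normal_distribution borel (\<lambda>z. z) = std_normal_distribution"
      by (rule distr_id2) simp
    finally show ?thesis
      using \<open>0 \<le> v\<close> by (simp add: char_std_normal_distribution power_mult_distrib)
  qed
  have eq: "distr M borel Y = N"
  proof (rule Levy_uniqueness)
    show "real_distribution (distr M borel Y)" by simp
    show "real_distribution N"
      unfolding N_def by (rule S.real_distribution_distr) (rule meas)
    show "char (distr M borel Y) = char N" using char charN by auto
  qed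
  have int: "integrable M (\<lambda>\<omega>. (Y \<omega>)^k) \<longleftrightarrow> integrable N (\<lambda>x. x ^ k)"
    "expectation (\<lambda>\<omega>. (Y \<omega>)^k) = (LINT x|N. x ^ k)" for k
    unfolding eq[symmetric] by (simp_all add: integrable_distr_eq integral_distr)
  have intN: "integrable N (\<lambda>x. x ^ k)" for k
    unfolding N_def using integrable_std_normal_distribution_moment[of k]
    by (simp add: integrable_distr_eq power_mult_distrib)
  have mom: "(LINT x|N. x ^ k) = sqrt v ^ k * (LINT x|std_normal_distribution. x ^ k)" for k
    unfolding N_def by (simp add: integral_distr power_mult_distrib)
  show "integrable M (\<lambda>\<omega>. (Y \<omega>)^2)" "integrable M (\<lambda>\<omega>. (Y \<omega>)^4)"
    using int(1) intN by auto
  show "expectation (\<lambda>\<omega>. (Y \<omega>)^2) = v"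
    unfolding int mom using std_normal_distribution_even_moments(1)[of 1] \<open>0 \<le> v\<close>
    by simp
  have "sqrt v ^ 4 = v\<^sup>2" using \<open>0 \<le> v\<close> 
    by (metis power2_eq_square power4_eq_xxxx real_sqrt_pow2 mult.assoc)
  then show "expectation (\<lambda>\<omega>. (Y \<omega>)^4) = 3 * v\<^sup>2"
    unfolding int mom using std_normal_distribution_even_moments(1)[of 2]
    by (simp add: fact_numeral)
qed

text \<open>Elementary integrands are combinations of \<open>indicator {0<..q}\<close> over an unordered finite set,
  so that two of them can be added without a common refinement of partitions.\<close>

definition elementary_integral ::
  "(real \<Rightarrow> 'w \<Rightarrow> real) \<Rightarrow> (real \<Rightarrow> real) \<Rightarrow> ('w \<Rightarrow> real) \<Rightarrow> bool" where
  "elementary_integral W f I \<longleftrightarrow> (\<exists>P d. finite P \<and> P \<subseteq> {0..1} \<and>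
     f = (\<lambda>s. \<Sum>q\<in>P. d q * indicator {0<..q} s) \<and>
     I = (\<lambda>\<omega>. \<Sum>q\<in>P. d q * (W q \<omega> - W 0 \<omega>)))"

lemma elementary_integral_scale:
  assumes "elementary_integral W f I"
  shows "elementary_integral W (\<lambda>s. a * f s) (\<lambda>\<omega>. a * I \<omega>)"
proof -
  from assms obtain P d where "finite P" "P \<subseteq> {0..1}"
    "f = (\<lambda>s. \<Sum>q\<in>P. d q * indicator {0<..q} s)" "I = (\<lambda>\<omega>. \<Sum>q\<in>P. d q * (W q \<omega> - W 0 \<omega>))"
    unfolding elementary_integral_def by blast
  then show ?thesis
    unfolding elementary_integral_def
    by (intro exI[of _ P] exI[of _ "\<lambda>q. a * d q"] conjI)
      (simp_all only: sum_distrib_left mult.assoc)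
qed

lemma elementary_integral_add:
  assumes "elementary_integral W f I" "elementary_integral W g J"
  shows "elementary_integral W (\<lambda>s. f s + g s) (\<lambda>\<omega>. I \<omega> + J \<omega>)"
proof -
  from assms(1) obtain P d where P: "finite P" "P \<subseteq> {0..1}"
    "f = (\<lambda>s. \<Sum>q\<in>P. d q * indicator {0<..q} s)" "I = (\<lambda>\<omega>. \<Sum>q\<in>P. d q * (W q \<omega> - W 0 \<omega>))"
    unfolding elementary_integral_def by blast
  from assms(2) obtain Q e where Q: "finite Q" "Q \<subseteq> {0..1}"
    "g = (\<lambda>s. \<Sum>q\<in>Q. e q * indicator {0<..q} s)" "J = (\<lambda>\<omega>. \<Sum>q\<in>Q. e q * (W q \<omega> - W 0 \<omega>))"
    unfolding elementary_integral_def by blast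
  define d' where "d' q = (if q \<in> P then d q else 0)" for q
  define e' where "e' q = (if q \<in> Q then e q else 0)" for q
  have 1: "(\<Sum>q\<in>P. d q * h q) = (\<Sum>q\<in>P\<union>Q. d' q * h q)" for h :: "real \<Rightarrow> real"
    using P(1) Q(1) by (intro sum.mono_neutral_cong_left) (auto simp: d'_def)
  have 2: "(\<Sum>q\<in>Q. e q * h q) = (\<Sum>q\<in>P\<union>Q. e' q * h q)" for h :: "real \<Rightarrow> real"
    using P(1) Q(1) by (intro sum.mono_neutral_cong_left) (auto simp: e'_def)
  have "(\<Sum>q\<in>P. d q * h q) + (\<Sum>q\<in>Q. e q * h q) = (\<Sum>q\<in>P\<union>Q. (d' q + e' q) * h q)" for h
    unfolding 1 2 by (simp add: sum.distrib distrib_right)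
  then show ?thesis
    unfolding elementary_integral_def P(3,4) Q(3,4) using P(1,2) Q(1,2)
    by (intro exI[of _ "P \<union> Q"] exI[of _ "\<lambda>q. d' q + e' q"] conjI) (simp_all only: finite_Un Un_least)
qed

lemma partition_mono:
  assumes "is_partition a b n p" "i \<le> j" "j \<le> n"
  shows "p i \<le> p j"
  using assms(2,3)
proof (induction j)
  case (Suc j)
  show ?case
  proof (cases "i \<le> j")
    case True
    then have "p i \<le> p j" using Suc by simp
    also have "p j \<le> p (Suc j)" using assms(1) Suc.prems by (simp add: is_partition_def)
    finally show ?thesis .
  qed (use Suc.prems in \<open>simp add: le_Suc_eq\<close>)
qed simp

lemma elementary_integral_step:
  assumes p: "is_partition 0 t n p" and "t \<le> 1"
  shows "elementary_integral W (step_fun n p c) (step_integral W n p c)"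
proof -
  define P where "P = p ` {..n}"
  \<comment> \<open>Since \<open>{p i<..p (Suc i)}\<close> is the difference of two intervals
    starting at 0, \<open>c i\<close> is credited to the right end point and debited from the left
    one. Points of \<open>p\<close> may coincide, so a value \<open>q\<close> collects from all its
    indices.\<close>
  define d where "d q = (\<Sum>i<n. c i * (of_bool (p (Suc i) = q) - of_bool (p i = q)))" for q
  have rng: "0 \<le> p i" "p i \<le> 1" if "i \<le> n" for i
    using partition_mono[OF p, of 0 i] partition_mono[OF p, of i n] p that \<open>t \<le> 1\<close>
    by (auto simp: is_partition_def)
  \<comment> \<open>Stated for arbitrary \<open>h\<close>, so that it applies both to
    \<open>h q = indicator {0<..q} s\<close> and to
    \<open>h q = W q \<omega> - W 0 \<omega>\<close>.\<close>
  have key: "(\<Sum>q\<in>P. d q * h q) = (\<Sum>i<n. c i * (h (p (Suc i)) - h (p i)))" for h :: "real \<Rightarrow> real"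
  proof -
    have "(\<Sum>q\<in>P. d q * h q) = (\<Sum>i<n. \<Sum>q\<in>P. c i * (of_bool (p (Suc i) = q) - of_bool (p i = q)) * h q)"
      unfolding d_def sum_distrib_right by (rule sum.swap)
    also have "\<dots> = (\<Sum>i<n. c i * (h (p (Suc i)) - h (p i)))"
    proof (rule sum.cong)
      fix i assume "i \<in> {..<n}"
      then have mem: "p (Suc i) \<in> P" "p i \<in> P" and fin: "finite P" by (auto simp: P_def)
      have "(\<Sum>q\<in>P. c i * (of_bool (p (Suc i) = q) - of_bool (p i = q)) * h q)
        = c i * ((\<Sum>q\<in>P. if p (Suc i) = q then h q else 0) - (\<Sum>q\<in>P. if p i = q then h q else 0))"
        unfolding sum_subtractf[symmetric] sum_distrib_left by (intro sum.cong) auto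
      then show "(\<Sum>q\<in>P. c i * (of_bool (p (Suc i) = q) - of_bool (p i = q)) * h q)
        = c i * (h (p (Suc i)) - h (p i))"
        using mem fin by simp
    qed simp
    finally show ?thesis .
  qed
  have "step_fun n p c = (\<lambda>s. \<Sum>q\<in>P. d q * indicator {0<..q} s)"
  proof
    fix s
    show "step_fun n p c s = (\<Sum>q\<in>P. d q * indicator {0<..q} s)"
      unfolding key step_fun_def
    proof (rule sum.cong)
      fix i assume "i \<in> {..<n}"
      then have "0 \<le> p i" "p i \<le> p (Suc i)" using rng p by (auto simp: is_partition_def)
      then show "c i * indicat_real {p i<..p (Suc i)} s
        = c i * (indicat_real {0<..p (Suc i)} s - indicat_real {0<..p i} s)"
        by (auto simp: indicator_def)
    qed simp
  qed
  moreover have "step_integral W n p c = (\<lambda>\<omega>. \<Sum>q\<in>P. d q * (W q \<omega> - W 0 \<omega>))"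
    unfolding key step_integral_def by simp
  moreover have "finite P" "P \<subseteq> {0..1}" using rng by (auto simp: P_def)
  ultimately show ?thesis unfolding elementary_integral_def by blast
qed

text \<open>Return to ordered points: independence of increments and disjointness of intervals are
  available only along a monotone enumeration.\<close>

lemma elementary_integral_partition:
  assumes "elementary_integral W f I"
  obtains n p C where "\<And>i. i \<le> n \<Longrightarrow> p i \<in> {0..1}" "\<And>i. i < n \<Longrightarrow> p i \<le> p (Suc i)"
    "f = step_fun n p C" "I = step_integral W n p C"
proof -
  from assms obtain P d where P: "finite P" "P \<subseteq> {0..1}"
    "f = (\<lambda>s. \<Sum>q\<in>P. d q * indicator {0<..q} s)" "I = (\<lambda>\<omega>. \<Sum>q\<in>P. d q * (W q \<omega> - W 0 \<omega>))"
    unfolding elementary_integral_def by blast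
  define xs where "xs = sorted_list_of_set P"
  define n where "n = length xs"
  \<comment> \<open>Prepending 0 makes the first interval start at 0. If 0 already lies in
    \<open>P\<close>, the first interval is empty, which weak monotonicity allows.\<close>
  define p where "p i = (0 # xs) ! i" for i
  \<comment> \<open>On a nonempty i-th interval the indicator of \<open>{0<..xs ! k}\<close> is 1
    exactly when \<open>i \<le> k\<close>, so the height there is the total weight of these
    points.\<close>
  define C where "C i = (\<Sum>k<n. if i \<le> k then d (xs ! k) else 0)" for i
  have set_xs: "set xs = P" "distinct xs" "sorted xs"
    using P(1) by (auto simp: xs_def)
  have rng: "p i \<in> {0..1}" if "i \<le> n" for i
  proof -
    have "p i \<in> set (0 # xs)" unfolding p_def using that by (intro nth_mem) (simp add: n_def)
    then show ?thesis using set_xs P(2) by auto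
  qed
  have mono: "p i \<le> p (Suc i)" if "i < n" for i
  proof -
    have "sorted (0 # xs)" using set_xs P(2) by auto
    then show ?thesis unfolding p_def using that by (intro sorted_nth_mono) (auto simp: n_def)
  qed
  \<comment> \<open>The telescoping starts at \<open>p 0 = 0\<close>, hence the condition on
    \<open>h 0\<close>; both choices of \<open>h\<close> satisfy it.\<close>
  have key: "(\<Sum>q\<in>P. d q * h q) = (\<Sum>i<n. C i * (h (p (Suc i)) - h (p i)))"
    if "h 0 = 0" for h :: "real \<Rightarrow> real"
  proof -
    have "(\<Sum>q\<in>P. d q * h q) = (\<Sum>k<n. d (xs ! k) * h (xs ! k))"
      using set_xs by (intro sum.reindex_bij_betw[symmetric, OF bij_betw_nth]) (auto simp: n_def)
    also have "\<dots> = (\<Sum>k<n. \<Sum>i<n. if i \<le> k then d (xs ! k) * (h (p (Suc i)) - h (p i)) else 0)"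
    proof (rule sum.cong)
      fix k assume k: "k \<in> {..<n}"
      have "h (xs ! k) = h (p (Suc k)) - h (p 0)" by (simp add: p_def that)
      also have "\<dots> = (\<Sum>i<Suc k. h (p (Suc i)) - h (p i))"
        by (rule sum_lessThan_telescope[symmetric])
      also have "{..<Suc k} = {..<n} \<inter> {i. i \<le> k}" using k by auto
      finally show "d (xs ! k) * h (xs ! k)
          = (\<Sum>i<n. if i \<le> k then d (xs ! k) * (h (p (Suc i)) - h (p i)) else 0)"
        by (auto simp add: sum_distrib_left sum.inter_restrict intro!: sum.cong)
    qed simp
    also have "\<dots> = (\<Sum>i<n. \<Sum>k<n. if i \<le> k then d (xs ! k) * (h (p (Suc i)) - h (p i)) else 0)"
      by (rule sum.swap)
    also have "\<dots> = (\<Sum>i<n. C i * (h (p (Suc i)) - h (p i)))"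
      unfolding C_def sum_distrib_right by (intro sum.cong) auto
    finally show ?thesis .
  qed
  show thesis
  proof (rule that[of n p C])
    show "f = step_fun n p C"
    proof
      fix s
      have "f s = (\<Sum>i<n. C i * (indicator {0<..p (Suc i)} s - indicator {0<..p i} s))"
        unfolding P(3) by (subst key) auto
      also have "\<dots> = step_fun n p C s"
        unfolding step_fun_def
      proof (rule sum.cong)
        fix i assume "i \<in> {..<n}"
        then have "0 \<le> p i" "p i \<le> p (Suc i)" using rng[of i] mono by auto
        then show "C i * (indicat_real {0<..p (Suc i)} s - indicat_real {0<..p i} s)
            = C i * indicat_real {p i<..p (Suc i)} s"
          by (auto simp: indicator_def)
      qed simp
      finally show "f s = step_fun n p C s" .
    qed
    show "I = step_integral W n p C"
      unfolding P(4) step_integral_def by (subst key) auto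
  qed (use rng mono in auto)
qed

text \<open>The half-open intervals of a partition are disjoint even when points repeat, so the
  square has no cross terms. The value is the variance of the matching
  \<open>step_integral\<close>.\<close>

lemma step_fun_L2:
  assumes "\<And>i. i < n \<Longrightarrow> p i \<le> p (Suc i)"
  shows "has_bochner_integral lborel (\<lambda>s. (step_fun n p c s)\<^sup>2)
    (\<Sum>i<n. (c i)\<^sup>2 * (p (Suc i) - p i))"
proof -
  have part: "is_partition (p 0) (p n) n p" using assms by (simp add: is_partition_def)
  have disj: "indicat_real {p i<..p (Suc i)} s * indicat_real {p j<..p (Suc j)} s
      = (if i = j then indicator {p i<..p (Suc i)} s else 0)" if "i < n" "j < n" for i j s
  proof -
    consider "i = j" | "Suc i \<le> j" | "Suc j \<le> i" by linarith
    then show ?thesis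
    proof cases
      case 2
      then show ?thesis using partition_mono[OF part 2] that by (auto simp: indicator_def)
    next
      case 3
      then show ?thesis using partition_mono[OF part 3] that by (auto simp: indicator_def)
    qed (auto simp: indicator_def)
  qed
  have "(step_fun n p c s)\<^sup>2 = (\<Sum>i<n. (c i)\<^sup>2 * indicator {p i<..p (Suc i)} s)" for s
  proof -
    have "(step_fun n p c s)\<^sup>2 = (\<Sum>i<n. \<Sum>j<n. c i * c j *
        (indicat_real {p i<..p (Suc i)} s * indicat_real {p j<..p (Suc j)} s))"
      unfolding step_fun_def power2_eq_square sum_product by (intro sum.cong) auto
    also have "\<dots> = (\<Sum>i<n. \<Sum>j<n. if i = j then c i * c j * indicator {p i<..p (Suc i)} s else 0)"
      by (intro sum.cong refl) (auto simp: disj)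
    also have "\<dots> = (\<Sum>i<n. (c i)\<^sup>2 * indicator {p i<..p (Suc i)} s)"
      by (simp add: power2_eq_square)
    finally show ?thesis .
  qed
  moreover have "has_bochner_integral lborel (\<lambda>s. \<Sum>i<n. (c i)\<^sup>2 * indicator {p i<..p (Suc i)} s)
    (\<Sum>i<n. (c i)\<^sup>2 * (p (Suc i) - p i))"
  proof (intro has_bochner_integral_sum has_bochner_integral_mult_right)
    fix i assume "i \<in> {..<n}"
    then have "p i \<le> p (Suc i)" using assms by simp
    then show "has_bochner_integral lborel (indicat_real {p i<..p (Suc i)}) (p (Suc i) - p i)"
      using has_bochner_integral_real_indicator[of "{p i<..p (Suc i)}" lborel] by simp
  qed
  ultimately show ?thesis by simp
qed

section \<open>Gaussian laws of elementary integrals\<close>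

text \<open>The definition of Brownian motion gives a law only for \<open>s < t\<close>; the
  characteristic function extends to \<open>s = t\<close>, which occurs when partition points
  repeat.\<close>

lemma brownian_increment_char:
  assumes bm: "standard_brownian_motion M W" and st: "s \<in> {0..1}" "t \<in> {0..1}" "s \<le> t"
  shows "char (distr M borel (\<lambda>\<omega>. c * (W t \<omega> - W s \<omega>))) x
    = complex_of_real (exp (- (c\<^sup>2 * (t - s) * x\<^sup>2) / 2))"
proof -
  interpret prob_space M using bm by (simp add: standard_brownian_motion_def)
  have [measurable]: "W s \<in> borel_measurable M" "W t \<in> borel_measurable M"
    using bm st by (auto simp: standard_brownian_motion_def)
  show ?thesis
  proof (cases "s = t")
    case True
    then show ?thesis by (simp add: char_def integral_distr prob_space del: distr_const)
  next
    case False
    define \<tau> where "\<tau> = sqrt (t - s)"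
    have \<tau>: "0 < \<tau>" "\<tau>\<^sup>2 = t - s" using False st by (auto simp: \<tau>_def)
    have "distributed M lborel (\<lambda>\<omega>. W t \<omega> - W s \<omega>) (\<lambda>x. ennreal (normal_density 0 \<tau> x))"
      using bm st False unfolding standard_brownian_motion_def \<tau>_def by auto
    then have "distributed M lborel (\<lambda>\<omega>. ((W t \<omega> - W s \<omega>) - 0) / \<tau>) (\<lambda>x. ennreal (std_normal_density x))"
      by (rule normal_standard_normal_convert[OF \<tau>(1), THEN iffD1])
    then have "distr M lborel (\<lambda>\<omega>. (W t \<omega> - W s \<omega>) / \<tau>) = std_normal_distribution"
      by (simp add: distributed_def)
    moreover have "distr M lborel (\<lambda>\<omega>. (W t \<omega> - W s \<omega>) / \<tau>) = distr M borel (\<lambda>\<omega>. (W t \<omega> - W s \<omega>) / \<tau>)"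
      by (rule distr_cong) auto
    ultimately have *: "distr M borel (\<lambda>\<omega>. (W t \<omega> - W s \<omega>) / \<tau>) = std_normal_distribution" by simp
    have "(\<lambda>\<omega>. c * (W t \<omega> - W s \<omega>)) = (\<lambda>\<omega>. (c * \<tau>) * ((W t \<omega> - W s \<omega>) / \<tau>))"
      using \<tau> by auto
    then have "char (distr M borel (\<lambda>\<omega>. c * (W t \<omega> - W s \<omega>))) x
      = char (distr M borel (\<lambda>\<omega>. (W t \<omega> - W s \<omega>) / \<tau>)) (c * \<tau> * x)"
      by (simp add: char_distr_mult[symmetric])
    then show ?thesis
      unfolding * by (simp add: char_std_normal_distribution power_mult_distrib \<tau>)
  qed
qed

text \<open>Independence turns the characteristic function into a product, and the exponents add up
  to the L2 norm from \<open>step_fun_L2\<close>: the Ito isometry in distributional form.\<close>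

lemma elementary_integral_gaussian:
  assumes bm: "standard_brownian_motion M W" and el: "elementary_integral W f I"
  shows "I \<in> borel_measurable M" "integrable lborel (\<lambda>s. (f s)\<^sup>2)" "f \<in> borel_measurable borel"
    "char (distr M borel I) x = complex_of_real (exp (- ((LINT s|lborel. (f s)\<^sup>2) * x\<^sup>2) / 2))"
proof -
  interpret prob_space M using bm by (simp add: standard_brownian_motion_def)
  obtain n p C where p: "\<And>i. i \<le> n \<Longrightarrow> p i \<in> {0..1}" "\<And>i. i < n \<Longrightarrow> p i \<le> p (Suc i)"
    and f: "f = step_fun n p C" and I: "I = step_integral W n p C"
    using elementary_integral_partition[OF el] by metis
  have [measurable]: "W (p i) \<in> borel_measurable M" if "i \<le> n" for i
    using bm p(1)[OF that] by (auto simp: standard_brownian_motion_def)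
  show "I \<in> borel_measurable M"
    unfolding I step_integral_def[abs_def] by (intro borel_measurable_sum) auto
  show "f \<in> borel_measurable borel" unfolding f step_fun_def[abs_def] by measurable
  have L2: "has_bochner_integral lborel (\<lambda>s. (f s)\<^sup>2) (\<Sum>i<n. (C i)\<^sup>2 * (p (Suc i) - p i))"
    unfolding f by (rule step_fun_L2) (rule p)
  then show "integrable lborel (\<lambda>s. (f s)\<^sup>2)" by (simp add: has_bochner_integral_iff)
  have indep: "indep_vars (\<lambda>_. borel) (\<lambda>i \<omega>. W (p (Suc i)) \<omega> - W (p i) \<omega>) {..<n}"
    using bm p unfolding standard_brownian_motion_def by blast
  have indep': "indep_vars (\<lambda>_. borel) (\<lambda>i \<omega>. C i * (W (p (Suc i)) \<omega> - W (p i) \<omega>)) {..<n}"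
    by (rule indep_vars_compose2[OF indep, of "\<lambda>i x. C i * x"]) auto
  have "char (distr M borel I) x = (\<Prod>i<n. char (distr M borel (\<lambda>\<omega>. C i * (W (p (Suc i)) \<omega> - W (p i) \<omega>))) x)"
    unfolding I step_integral_def[abs_def] by (rule char_distr_sum[OF indep'])
  also have "\<dots> = (\<Prod>i<n. complex_of_real (exp (- ((C i)\<^sup>2 * (p (Suc i) - p i) * x\<^sup>2) / 2)))"
    using p by (intro prod.cong refl brownian_increment_char[OF bm]) auto
  also have "\<dots> = complex_of_real (exp (\<Sum>i<n. - ((C i)\<^sup>2 * (p (Suc i) - p i) * x\<^sup>2) / 2))"
    by (simp add: exp_sum)
  also have "(\<Sum>i<n. - ((C i)\<^sup>2 * (p (Suc i) - p i) * x\<^sup>2) / 2)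
    = - ((LINT s|lborel. (f s)\<^sup>2) * x\<^sup>2) / 2"
    using has_bochner_integral_integral_eq[OF L2]
    by (simp add: sum_distrib_right sum_divide_distrib sum_negf)
  finally show "char (distr M borel I) x = complex_of_real (exp (- ((LINT s|lborel. (f s)\<^sup>2) * x\<^sup>2) / 2))" .
qed

section \<open>L2 limits of elementary integrals\<close>

text \<open>Young's inequality \<open>2 x y \<le> \<delta> x^2 + y^2 / \<delta>\<close> leaves a
  term that does not vanish but carries an arbitrarily small factor; this is the limit argument that
  goes with it.\<close>

lemma tendsto_zero_young:
  fixes a E :: "nat \<Rightarrow> real"
  assumes E: "E \<longlonglongrightarrow> 0" and A: "0 \<le> A"
    and le: "\<And>\<delta>. 0 < \<delta> \<Longrightarrow> eventually (\<lambda>k. \<bar>a k\<bar> \<le> \<delta> * A + (B + C / \<delta>) * E k) sequentially"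
  shows "a \<longlonglongrightarrow> 0"
proof (rule tendstoI)
  fix e :: real assume e: "0 < e"
  \<comment> \<open>The \<open>+ 1\<close> covers the case \<open>A = 0\<close>.\<close>
  define \<delta> where "\<delta> = e / (2 * (A + 1))"
  have \<delta>: "0 < \<delta>" using e A by (simp add: \<delta>_def)
  have "(\<lambda>k. \<delta> * A + (B + C / \<delta>) * E k) \<longlonglongrightarrow> \<delta> * A + (B + C / \<delta>) * 0"
    by (intro tendsto_intros E)
  moreover have "\<delta> * A < e"
    using e A by (simp add: \<delta>_def field_simps) (metis add_nonneg_pos mult_nonneg_nonneg less_imp_le mult_pos_pos zero_less_numeral)
  ultimately have "eventually (\<lambda>k. \<delta> * A + (B + C / \<delta>) * E k < e) sequentially"
    by (intro order_tendstoD(2)[where y = "\<delta> * A"]) auto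
  with le[OF \<delta>] show "eventually (\<lambda>k. dist (a k) 0 < e) sequentially"
    by eventually_elim (auto simp: dist_real_def)
qed

lemma L2_null_add:
  fixes f g :: "nat \<Rightarrow> 'a \<Rightarrow> real"
  assumes [measurable]: "\<And>k. f k \<in> borel_measurable M" "\<And>k. g k \<in> borel_measurable M"
    and f: "(\<lambda>k. \<integral>\<^sup>+x. ennreal ((f k x)\<^sup>2) \<partial>M) \<longlonglongrightarrow> 0"
    and g: "(\<lambda>k. \<integral>\<^sup>+x. ennreal ((g k x)\<^sup>2) \<partial>M) \<longlonglongrightarrow> 0"
  shows "(\<lambda>k. \<integral>\<^sup>+x. ennreal ((f k x + g k x)\<^sup>2) \<partial>M) \<longlonglongrightarrow> 0"
proof (rule tendsto_sandwich[OF _ _ tendsto_const])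
  have "(f k x + g k x)\<^sup>2 \<le> 2 * (f k x)\<^sup>2 + 2 * (g k x)\<^sup>2" for k x
    using sum_squares_bound[of "f k x" "g k x"] by (simp add: power2_sum)
  then have *: "ennreal ((f k x + g k x)\<^sup>2) \<le> 2 * ennreal ((f k x)\<^sup>2) + 2 * ennreal ((g k x)\<^sup>2)" for k x
    using ennreal_leI[of "(f k x + g k x)\<^sup>2" "2 * (f k x)\<^sup>2 + 2 * (g k x)\<^sup>2"]
    by (simp add: ennreal_plus ennreal_mult')
  have "(\<integral>\<^sup>+x. ennreal ((f k x + g k x)\<^sup>2) \<partial>M)
      \<le> (\<integral>\<^sup>+x. 2 * ennreal ((f k x)\<^sup>2) + 2 * ennreal ((g k x)\<^sup>2) \<partial>M)" for k
    by (intro nn_integral_mono) (rule *)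
  also have "(\<integral>\<^sup>+x. 2 * ennreal ((f k x)\<^sup>2) + 2 * ennreal ((g k x)\<^sup>2) \<partial>M)
      = 2 * (\<integral>\<^sup>+x. ennreal ((f k x)\<^sup>2) \<partial>M) + 2 * (\<integral>\<^sup>+x. ennreal ((g k x)\<^sup>2) \<partial>M)" for k
    by (simp add: nn_integral_add nn_integral_cmult)
  finally show "eventually (\<lambda>k. (\<integral>\<^sup>+x. ennreal ((f k x + g k x)\<^sup>2) \<partial>M)
      \<le> 2 * (\<integral>\<^sup>+x. ennreal ((f k x)\<^sup>2) \<partial>M) + 2 * (\<integral>\<^sup>+x. ennreal ((g k x)\<^sup>2) \<partial>M)) sequentially"
    by simp
  show "(\<lambda>k. 2 * (\<integral>\<^sup>+x. ennreal ((f k x)\<^sup>2) \<partial>M) + 2 * (\<integral>\<^sup>+x. ennreal ((g k x)\<^sup>2) \<partial>M)) \<longlonglongrightarrow> 0"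
    using tendsto_add[OF ennreal_tendsto_cmult[OF _ f, of 2] ennreal_tendsto_cmult[OF _ g, of 2]] by simp
qed simp

lemma L2_null_scale:
  fixes f :: "nat \<Rightarrow> 'a \<Rightarrow> real"
  assumes [measurable]: "\<And>k. f k \<in> borel_measurable M"
    and f: "(\<lambda>k. \<integral>\<^sup>+x. ennreal ((f k x)\<^sup>2) \<partial>M) \<longlonglongrightarrow> 0"
  shows "(\<lambda>k. \<integral>\<^sup>+x. ennreal ((a * f k x)\<^sup>2) \<partial>M) \<longlonglongrightarrow> 0"
proof -
  have "(\<integral>\<^sup>+x. ennreal ((a * f k x)\<^sup>2) \<partial>M) = ennreal (a\<^sup>2) * (\<integral>\<^sup>+x. ennreal ((f k x)\<^sup>2) \<partial>M)" for k
    by (simp add: power_mult_distrib ennreal_mult nn_integral_cmult)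
  then show ?thesis using ennreal_tendsto_cmult[OF _ f, of "ennreal (a\<^sup>2)"] by simp
qed

text \<open>\<open>has_wiener_integral\<close> ties the approximants to partitions of
  \<open>[0,t]\<close>, which excludes increments and linear combinations. Here the integrand lives
  on the whole line and the approximants are elementary, so the relation is closed under both
  operations.\<close>

definition wiener_limit ::
  "'w measure \<Rightarrow> (real \<Rightarrow> 'w \<Rightarrow> real) \<Rightarrow> (real \<Rightarrow> real) \<Rightarrow> ('w \<Rightarrow> real) \<Rightarrow> bool" where
  "wiener_limit M W f Y \<longleftrightarrow> f \<in> borel_measurable borel \<and> Y \<in> borel_measurable M \<and>
     (\<exists>F I. (\<forall>k. elementary_integral W (F k) (I k)) \<and>
        (\<lambda>k. \<integral>\<^sup>+s. ennreal ((f s - F k s)\<^sup>2) \<partial>lborel) \<longlonglongrightarrow> 0 \<and>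
        (\<lambda>k. \<integral>\<^sup>+\<omega>. ennreal ((Y \<omega> - I k \<omega>)\<^sup>2) \<partial>M) \<longlonglongrightarrow> 0)"

lemma wiener_limit_scale:
  assumes "standard_brownian_motion M W" "wiener_limit M W f Y"
  shows "wiener_limit M W (\<lambda>s. a * f s) (\<lambda>\<omega>. a * Y \<omega>)"
proof -
  from assms(2) obtain F I where [measurable]: "f \<in> borel_measurable borel" "Y \<in> borel_measurable M"
    and el: "\<And>k. elementary_integral W (F k) (I k)"
    and lim: "(\<lambda>k. \<integral>\<^sup>+s. ennreal ((f s - F k s)\<^sup>2) \<partial>lborel) \<longlonglongrightarrow> 0"
       "(\<lambda>k. \<integral>\<^sup>+\<omega>. ennreal ((Y \<omega> - I k \<omega>)\<^sup>2) \<partial>M) \<longlonglongrightarrow> 0"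
    unfolding wiener_limit_def by blast
  have [measurable]: "F k \<in> borel_measurable borel" "I k \<in> borel_measurable M" for k
    using elementary_integral_gaussian[OF assms(1) el] by auto
  show ?thesis
    unfolding wiener_limit_def
    using L2_null_scale[OF _ lim(1), of a] L2_null_scale[OF _ lim(2), of a]
    by (intro conjI exI[of _ "\<lambda>k s. a * F k s"] exI[of _ "\<lambda>k \<omega>. a * I k \<omega>"] allI
        elementary_integral_scale el) (auto simp: right_diff_distrib)
qed

lemma wiener_limit_add:
  assumes "standard_brownian_motion M W" "wiener_limit M W f Y" "wiener_limit M W g Z"
  shows "wiener_limit M W (\<lambda>s. f s + g s) (\<lambda>\<omega>. Y \<omega> + Z \<omega>)"
proof -
  from assms(2) obtain F I where [measurable]: "f \<in> borel_measurable borel" "Y \<in> borel_measurable M"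
    and el: "\<And>k. elementary_integral W (F k) (I k)"
    and lim: "(\<lambda>k. \<integral>\<^sup>+s. ennreal ((f s - F k s)\<^sup>2) \<partial>lborel) \<longlonglongrightarrow> 0"
       "(\<lambda>k. \<integral>\<^sup>+\<omega>. ennreal ((Y \<omega> - I k \<omega>)\<^sup>2) \<partial>M) \<longlonglongrightarrow> 0"
    unfolding wiener_limit_def by blast
  from assms(3) obtain G J where [measurable]: "g \<in> borel_measurable borel" "Z \<in> borel_measurable M"
    and el': "\<And>k. elementary_integral W (G k) (J k)"
    and lim': "(\<lambda>k. \<integral>\<^sup>+s. ennreal ((g s - G k s)\<^sup>2) \<partial>lborel) \<longlonglongrightarrow> 0"
       "(\<lambda>k. \<integral>\<^sup>+\<omega>. ennreal ((Z \<omega> - J k \<omega>)\<^sup>2) \<partial>M) \<longlonglongrightarrow> 0"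
    unfolding wiener_limit_def by blast
  have [measurable]: "F k \<in> borel_measurable borel" "I k \<in> borel_measurable M"
    "G k \<in> borel_measurable borel" "J k \<in> borel_measurable M" for k
    using elementary_integral_gaussian[OF assms(1) el] elementary_integral_gaussian[OF assms(1) el'] by auto
  show ?thesis
    unfolding wiener_limit_def
    using L2_null_add[OF _ _ lim(1) lim'(1)] L2_null_add[OF _ _ lim(2) lim'(2)]
    by (intro conjI exI[of _ "\<lambda>k s. F k s + G k s"] exI[of _ "\<lambda>k \<omega>. I k \<omega> + J k \<omega>"] allI
        elementary_integral_add el el') (simp_all add: add_diff_add)
qed

text \<open>Step functions over a partition of \<open>[0,t]\<close> vanish outside it, so cutting
  off \<open>f\<close> turns the integral over \<open>[0,t]\<close> into one over the line.\<close>

lemma has_wiener_integral_imp_wiener_limit: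
  assumes "standard_brownian_motion M W" "has_wiener_integral M W f t Y" "0 \<le> t" "t \<le> 1"
  shows "wiener_limit M W (\<lambda>s. indicator {0..t} s * f s) Y"
proof -
  from assms(2) obtain N p c where m: "set_borel_measurable lborel {0..t} f" "Y \<in> borel_measurable M"
    and p: "\<And>k. is_partition 0 t (N k) (p k)"
    and lim: "(\<lambda>k. \<integral>\<^sup>+s\<in>{0..t}. ennreal ((f s - step_fun (N k) (p k) (c k) s)\<^sup>2) \<partial>lborel) \<longlonglongrightarrow> 0"
      "(\<lambda>k. \<integral>\<^sup>+\<omega>. ennreal ((Y \<omega> - step_integral W (N k) (p k) (c k) \<omega>)\<^sup>2) \<partial>M) \<longlonglongrightarrow> 0"
    unfolding has_wiener_integral_def by blast
  have "step_fun (N k) (p k) (c k) s = 0" if "s \<notin> {0..t}" for k s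
    unfolding step_fun_def
  proof (intro sum.neutral ballI)
    fix i assume "i \<in> {..<N k}"
    then have "0 \<le> p k i" "p k (Suc i) \<le> t"
      using partition_mono[OF p, of 0 i k] partition_mono[OF p, of "Suc i" "N k" k] p[of k]
      by (auto simp: is_partition_def)
    then show "c k i * indicat_real {p k i<..p k (Suc i)} s = 0"
      using that by (auto simp: indicator_def)
  qed
  then have "ennreal ((indicator {0..t} s * f s - step_fun (N k) (p k) (c k) s)\<^sup>2)
      = ennreal ((f s - step_fun (N k) (p k) (c k) s)\<^sup>2) * indicator {0..t} s" for k s
    by (auto simp: indicator_def)
  then show ?thesis
    unfolding wiener_limit_def using m lim elementary_integral_step[OF p \<open>t \<le> 1\<close>]
    by (intro conjI exI[of _ "\<lambda>k. step_fun (N k) (p k) (c k)"] exI[of _ "\<lambda>k. step_integral W (N k) (p k) (c k)"])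
      (auto simp: set_borel_measurable_def)
qed

text \<open>Two limits of the characteristic functions of the \<open>I k\<close> are compared: one
  from the convergence of the L2 norms of the \<open>F k\<close>, the other from the L2 convergence
  of the \<open>I k\<close> to \<open>Y\<close>.\<close>

lemma wiener_limit_char:
  assumes bm: "standard_brownian_motion M W" and wl: "wiener_limit M W f Y"
    and int_f: "integrable lborel (\<lambda>s. (f s)\<^sup>2)"
  shows "char (distr M borel Y) t = complex_of_real (exp (- ((LINT s|lborel. (f s)\<^sup>2) * t\<^sup>2) / 2))"
proof -
  interpret prob_space M using bm by (simp add: standard_brownian_motion_def)
  from wl obtain F I where [measurable]: "f \<in> borel_measurable borel" "Y \<in> borel_measurable M"
    and el: "\<And>k. elementary_integral W (F k) (I k)"
    and limF: "(\<lambda>k. \<integral>\<^sup>+s. ennreal ((f s - F k s)\<^sup>2) \<partial>lborel) \<longlonglongrightarrow> 0"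
    and limI: "(\<lambda>k. \<integral>\<^sup>+\<omega>. ennreal ((Y \<omega> - I k \<omega>)\<^sup>2) \<partial>M) \<longlonglongrightarrow> 0"
    unfolding wiener_limit_def by blast
  note G = elementary_integral_gaussian[OF bm el]
  have [measurable]: "F k \<in> borel_measurable borel" "I k \<in> borel_measurable M" for k
    using G by auto
  let ?v = "LINT s|lborel. (f s)\<^sup>2"
  have real_lim: "(\<lambda>k. enn2real (e k)) \<longlonglongrightarrow> 0" if "e \<longlonglongrightarrow> 0" for e :: "nat \<Rightarrow> ennreal"
    by (rule tendsto_enn2real) (use that in auto)
  \<comment> \<open>For small \<open>k\<close> the integral may be infinite, and
    \<open>enn2real\<close> would then return 0; the estimates below are made where it is
    finite.\<close>
  have fin: "eventually (\<lambda>k. e k < \<top>) sequentially" if "e \<longlonglongrightarrow> (0::ennreal)" for e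
    using order_tendstoD(2)[OF that, of \<top>] by simp
  have "(\<lambda>k. (LINT s|lborel. (F k s)\<^sup>2) - ?v) \<longlonglongrightarrow> 0"
  proof (rule tendsto_zero_young[OF real_lim[OF limF], of ?v _ 1 1])
    show "0 \<le> ?v" by simp
    fix \<delta> :: real assume \<delta>: "0 < \<delta>"
    show "eventually (\<lambda>k. \<bar>(LINT s|lborel. (F k s)\<^sup>2) - ?v\<bar> \<le> \<delta> * ?v
        + (1 + 1 / \<delta>) * enn2real (\<integral>\<^sup>+s. ennreal ((f s - F k s)\<^sup>2) \<partial>lborel)) sequentially"
      using fin[OF limF]
    proof eventually_elim
      case (elim k)
      have int: "integrable lborel (\<lambda>s. (f s - F k s)\<^sup>2)"
        by (rule integrableI_nonneg) (use elim in auto)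
      have eq: "enn2real (\<integral>\<^sup>+s. ennreal ((f s - F k s)\<^sup>2) \<partial>lborel) = (LINT s|lborel. (f s - F k s)\<^sup>2)"
        by (rule integral_eq_nn_integral[symmetric]) auto
      \<comment> \<open>Young's inequality for the cross term of
        \<open>y^2 - x^2 = - 2 x (x - y) + (x - y)^2\<close>.\<close>
      have "\<bar>y\<^sup>2 - x\<^sup>2\<bar> \<le> \<delta> * x\<^sup>2 + (1 + 1 / \<delta>) * (x - y)\<^sup>2" for x y :: real
      proof -
        have "0 \<le> (\<delta> * \<bar>x\<bar> - \<bar>x - y\<bar>)\<^sup>2 / \<delta>" using \<delta> by simp
        also have "\<dots> = \<delta> * x\<^sup>2 + (1 / \<delta>) * (x - y)\<^sup>2 - 2 * \<bar>x\<bar> * \<bar>x - y\<bar>"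
          using \<delta> by (simp add: power2_diff field_simps) (simp add: power2_eq_square)
        finally have "2 * \<bar>x\<bar> * \<bar>x - y\<bar> \<le> \<delta> * x\<^sup>2 + (1 / \<delta>) * (x - y)\<^sup>2" by simp
        moreover have "\<bar>y\<^sup>2 - x\<^sup>2\<bar> \<le> 2 * \<bar>x\<bar> * \<bar>x - y\<bar> + (x - y)\<^sup>2"
        proof -
          have "y\<^sup>2 - x\<^sup>2 = - 2 * x * (x - y) + (x - y)\<^sup>2" by (simp add: power2_eq_square algebra_simps)
          also have "\<bar>\<dots>\<bar> \<le> \<bar>- 2 * x * (x - y)\<bar> + \<bar>(x - y)\<^sup>2\<bar>" by (rule abs_triangle_ineq)
          finally show ?thesis by (simp add: abs_mult)
        qed
        ultimately show ?thesis by (simp add: algebra_simps)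
      qed
      then have "\<bar>LINT s|lborel. (F k s)\<^sup>2 - (f s)\<^sup>2\<bar>
          \<le> (LINT s|lborel. \<delta> * (f s)\<^sup>2 + (1 + 1 / \<delta>) * (f s - F k s)\<^sup>2)"
        using int int_f G(2)[of k]
        by (intro order_trans[OF integral_abs_bound] integral_mono) auto
      then show ?case
        unfolding eq using int int_f G(2)[of k] by simp
    qed
  qed
  then have "(\<lambda>k. LINT s|lborel. (F k s)\<^sup>2) \<longlonglongrightarrow> ?v" by (simp add: LIM_zero_iff)
  then have "(\<lambda>k. char (distr M borel (I k)) t) \<longlonglongrightarrow> complex_of_real (exp (- (?v * t\<^sup>2) / 2))"
    unfolding G(4) by (intro tendsto_intros) auto
  moreover have "(\<lambda>k. char (distr M borel (I k)) t) \<longlonglongrightarrow> char (distr M borel Y) t"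
  proof -
    have "(\<lambda>k. cmod (char (distr M borel (I k)) t - char (distr M borel Y) t)) \<longlonglongrightarrow> 0"
    proof (rule tendsto_zero_young[OF real_lim[OF limI], of 1 _ 0 "t\<^sup>2"])
      fix \<delta> :: real assume \<delta>: "0 < \<delta>"
      show "eventually (\<lambda>k. \<bar>cmod (char (distr M borel (I k)) t - char (distr M borel Y) t)\<bar> \<le> \<delta> * 1
          + (0 + t\<^sup>2 / \<delta>) * enn2real (\<integral>\<^sup>+\<omega>. ennreal ((Y \<omega> - I k \<omega>)\<^sup>2) \<partial>M)) sequentially"
        using fin[OF limI]
      proof eventually_elim
        case (elim k)
        have int: "integrable M (\<lambda>\<omega>. (Y \<omega> - I k \<omega>)\<^sup>2)"
          by (rule integrableI_nonneg) (use elim in auto)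
        have eq: "enn2real (\<integral>\<^sup>+\<omega>. ennreal ((Y \<omega> - I k \<omega>)\<^sup>2) \<partial>M) = expectation (\<lambda>\<omega>. (Y \<omega> - I k \<omega>)\<^sup>2)"
          by (rule integral_eq_nn_integral[symmetric]) auto
        have ie: "integrable M (\<lambda>\<omega>. iexp (t * Z \<omega>))" if [measurable]: "Z \<in> borel_measurable M" for Z
          by (rule integrable_iexp) auto
        \<comment> \<open>\<open>iexp\<close> is 1-Lipschitz, and
          \<open>\<bar>u\<bar> \<le> \<delta> + u^2 / \<delta>\<close> trades the first power of the
          error for its square, whose integral is the one under control.\<close>
        have bd: "cmod (iexp (t * x) - iexp (t * y)) \<le> \<delta> + t\<^sup>2 / \<delta> * (y - x)\<^sup>2" for x y :: real
        proof -
          have "cmod (iexp (t * x) - iexp (t * y)) = cmod (iexp (t * (x - y)) - 1)"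
          proof -
            have "iexp (t * x) - iexp (t * y) = iexp (t * y) * (iexp (t * (x - y)) - 1)"
              by (simp add: exp_add[symmetric] algebra_simps)
            then show ?thesis by (simp add: norm_mult del: of_real_mult)
          qed
          also have "\<dots> \<le> \<bar>t * (x - y)\<bar>"
            using iexp_approx1[of "t * (x - y)" 0] by simp
          also have "\<dots> \<le> \<delta> + t\<^sup>2 / \<delta> * (y - x)\<^sup>2"
          proof -
            have "\<bar>u\<bar> \<le> \<delta> + u\<^sup>2 / \<delta>" for u :: real
            proof (cases "\<bar>u\<bar> \<le> \<delta>")
              case False
              then have "\<bar>u\<bar> * \<delta> \<le> \<bar>u\<bar> * \<bar>u\<bar>" using \<delta> by (intro mult_left_mono) auto
              then have "\<bar>u\<bar> \<le> u\<^sup>2 / \<delta>" using \<delta> by (simp add: field_simps power2_eq_square)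
              then show ?thesis using \<delta> by linarith
            qed (use \<delta> in \<open>simp add: add_increasing2\<close>)
            from this[of "t * (x - y)"] show ?thesis
              by (simp add: power_mult_distrib power2_commute)
          qed
          finally show ?thesis .
        qed
        have "cmod (char (distr M borel (I k)) t - char (distr M borel Y) t)
          = cmod (CLINT \<omega>|M. iexp (t * I k \<omega>) - iexp (t * Y \<omega>))"
          unfolding char_def by (simp add: integral_distr ie del: of_real_mult)
        also have "\<dots> \<le> (LINT \<omega>|M. cmod (iexp (t * I k \<omega>) - iexp (t * Y \<omega>)))"
          by (rule integral_norm_bound)
        also have "\<dots> \<le> (LINT \<omega>|M. \<delta> + t\<^sup>2 / \<delta> * (Y \<omega> - I k \<omega>)\<^sup>2)"
          by (intro integral_mono integrable_norm Bochner_Integration.integrable_diff ie bd) (use int in auto)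
        also have "\<dots> = \<delta> + t\<^sup>2 / \<delta> * expectation (\<lambda>\<omega>. (Y \<omega> - I k \<omega>)\<^sup>2)"
          using int by (simp add: prob_space)
        finally show ?case unfolding eq by simp
      qed
    qed simp
    then show ?thesis by (simp add: tendsto_norm_zero_iff LIM_zero_iff)
  qed
  ultimately show ?thesis by (metis LIMSEQ_unique)
qed

section \<open>Moments of the increments\<close>

text \<open>Cramer-Wold in moment form: the laws of the combinations \<open>a Y + b Z\<close>
  determine the mixed moment, without passing through the joint law of \<open>Y\<close> and
  \<open>Z\<close>.\<close>

lemma (in prob_space) gaussian_pair_moments:
  fixes Y Z :: "'a \<Rightarrow> real"
  assumes [measurable]: "Y \<in> borel_measurable M" "Z \<in> borel_measurable M"
    and "0 \<le> v" "0 \<le> w"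
    and char: "\<And>a b t. char (distr M borel (\<lambda>\<omega>. a * Y \<omega> + b * Z \<omega>)) t
      = complex_of_real (exp (- ((a\<^sup>2 * v + b\<^sup>2 * w) * t\<^sup>2) / 2))"
  shows "integrable M (\<lambda>\<omega>. (Y \<omega>)\<^sup>2 * (Z \<omega>)\<^sup>2)"
    "expectation (\<lambda>\<omega>. (Y \<omega>)\<^sup>2 * (Z \<omega>)\<^sup>2) = v * w"
proof -
  have m: "integrable M (\<lambda>\<omega>. (a * Y \<omega> + b * Z \<omega>)^4)"
    "expectation (\<lambda>\<omega>. (a * Y \<omega> + b * Z \<omega>)^4) = 3 * (a\<^sup>2 * v + b\<^sup>2 * w)\<^sup>2" for a b
    using gaussian_moments(3,4)[OF _ _ char[of a b]] \<open>0 \<le> v\<close> \<open>0 \<le> w\<close> by simp_all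
  \<comment> \<open>polarisation of the fourth moment\<close>
  have eq: "(Y \<omega>)\<^sup>2 * (Z \<omega>)\<^sup>2 = ((1 * Y \<omega> + 1 * Z \<omega>)^4 + (1 * Y \<omega> + (-1) * Z \<omega>)^4
      - 2 * (1 * Y \<omega> + 0 * Z \<omega>)^4 - 2 * (0 * Y \<omega> + 1 * Z \<omega>)^4) / 12" for \<omega>
    by (simp add: power4_eq_xxxx power2_eq_square algebra_simps)
  have "has_bochner_integral M (\<lambda>\<omega>. ((1 * Y \<omega> + 1 * Z \<omega>)^4 + (1 * Y \<omega> + (-1) * Z \<omega>)^4
      - 2 * (1 * Y \<omega> + 0 * Z \<omega>)^4 - 2 * (0 * Y \<omega> + 1 * Z \<omega>)^4) / 12)
     ((3 * (1\<^sup>2 * v + 1\<^sup>2 * w)\<^sup>2 + 3 * (1\<^sup>2 * v + (-1)\<^sup>2 * w)\<^sup>2 - 2 * (3 * (1\<^sup>2 * v + 0\<^sup>2 * w)\<^sup>2)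
        - 2 * (3 * (0\<^sup>2 * v + 1\<^sup>2 * w)\<^sup>2)) / 12)"
    by (intro has_bochner_integral_divide_zero has_bochner_integral_add has_bochner_integral_diff
       has_bochner_integral_mult_right) (use m in \<open>auto simp only: has_bochner_integral_iff\<close>)
  also have "((3 * (1\<^sup>2 * v + 1\<^sup>2 * w)\<^sup>2 + 3 * (1\<^sup>2 * v + (-1)\<^sup>2 * w)\<^sup>2 - 2 * (3 * (1\<^sup>2 * v + 0\<^sup>2 * w)\<^sup>2)
        - 2 * (3 * (0\<^sup>2 * v + 1\<^sup>2 * w)\<^sup>2)) / 12) = v * w"
    by (simp add: power2_eq_square algebra_simps)
  finally have "has_bochner_integral M (\<lambda>\<omega>. (Y \<omega>)\<^sup>2 * (Z \<omega>)\<^sup>2) (v * w)"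
    unfolding eq .
  then show "integrable M (\<lambda>\<omega>. (Y \<omega>)\<^sup>2 * (Z \<omega>)\<^sup>2)"
    "expectation (\<lambda>\<omega>. (Y \<omega>)\<^sup>2 * (Z \<omega>)\<^sup>2) = v * w"
    by (auto simp: has_bochner_integral_iff)
qed

text \<open>As a set, \<open>{s<..t}\<close> is exactly \<open>{0..t}\<close> minus
  \<open>{0..s}\<close>; the half-open form makes the integrands of adjacent increments
  disjoint.\<close>

lemma wiener_increment_limit:
  assumes bm: "standard_brownian_motion M W"
    and X: "\<forall>t\<in>{0..1}. has_wiener_integral M W \<sigma> t (X t)"
    and st: "0 \<le> s" "s \<le> t" "t \<le> 1"
  shows "wiener_limit M W (\<lambda>u. indicator {s<..t} u * \<sigma> u) (\<lambda>\<omega>. X t \<omega> - X s \<omega>)"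
proof -
  have "wiener_limit M W (\<lambda>u. indicator {0..t} u * \<sigma> u + (-1) * (indicator {0..s} u * \<sigma> u))
     (\<lambda>\<omega>. X t \<omega> + (-1) * X s \<omega>)"
    using X st
    by (intro wiener_limit_add[OF bm] wiener_limit_scale[OF bm] has_wiener_integral_imp_wiener_limit[OF bm]) auto
  moreover have "(\<lambda>u. indicator {0..t} u * \<sigma> u + (-1) * (indicator {0..s} u * \<sigma> u))
      = (\<lambda>u. indicator {s<..t} u * \<sigma> u)"
    using st by (auto simp: indicator_def fun_eq_iff)
  ultimately show ?thesis by simp
qed

lemma wiener_increment_moments:
  assumes bm: "standard_brownian_motion M W"
    and X: "\<forall>t\<in>{0..1}. has_wiener_integral M W \<sigma> t (X t)"
    and int: "set_integrable lborel {0..1} (\<lambda>u. (\<sigma> u)\<^sup>2)"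
    and st: "0 \<le> s" "s \<le> t" "t \<le> 1"
  defines "v \<equiv> (\<lambda>s t. LINT u:{s<..t}|lborel. (\<sigma> u)\<^sup>2)"
  defines "D \<equiv> (\<lambda>s t \<omega>. X t \<omega> - X s \<omega>)"
  shows "integrable M (\<lambda>\<omega>. (D s t \<omega>)^2)" "(LINT \<omega>|M. (D s t \<omega>)^2) = v s t"
    "integrable M (\<lambda>\<omega>. (D s t \<omega>)^4)" "(LINT \<omega>|M. (D s t \<omega>)^4) = 3 * (v s t)\<^sup>2"
    "\<lbrakk>t \<le> s'; s' \<le> t'; t' \<le> 1\<rbrakk> \<Longrightarrow> integrable M (\<lambda>\<omega>. (D s t \<omega>)\<^sup>2 * (D s' t' \<omega>)\<^sup>2)"
    "\<lbrakk>t \<le> s'; s' \<le> t'; t' \<le> 1\<rbrakk> \<Longrightarrow> (LINT \<omega>|M. (D s t \<omega>)\<^sup>2 * (D s' t' \<omega>)\<^sup>2) = v s t * v s' t'"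
proof -
  interpret prob_space M using bm by (simp add: standard_brownian_motion_def)
  have meas[measurable]: "X t \<in> borel_measurable M" if "0 \<le> t" "t \<le> 1" for t
    using X that by (auto simp: has_wiener_integral_def)
  have int': "integrable lborel (\<lambda>u. indicator {s<..t} u * (\<sigma> u)\<^sup>2)" if "0 \<le> s" "t \<le> 1" for s t
  proof -
    have "{s<..t} \<subseteq> {0..1}" using that by auto
    from set_integrable_subset[OF int _ this] show ?thesis by (simp add: set_integrable_def)
  qed
  have v: "(LINT u|lborel. indicator {s<..t} u * (\<sigma> u)\<^sup>2) = v s t" for s t
    by (simp add: v_def set_lebesgue_integral_def)
  have v0: "0 \<le> v s t" for s t
    unfolding v[symmetric] by (intro Bochner_Integration.integral_nonneg) auto
  have char: "char (distr M borel (\<lambda>\<omega>. a * D s t \<omega> + b * D s' t' \<omega>)) x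
      = complex_of_real (exp (- ((a\<^sup>2 * v s t + b\<^sup>2 * v s' t') * x\<^sup>2) / 2))"
    if "t \<le> s'" "s' \<le> t'" "t' \<le> 1" for s' t' a b x
  proof -
    let ?f = "\<lambda>u. a * (indicator {s<..t} u * \<sigma> u) + b * (indicator {s'<..t'} u * \<sigma> u)"
    have wl: "wiener_limit M W ?f (\<lambda>\<omega>. a * D s t \<omega> + b * D s' t' \<omega>)"
      unfolding D_def using st that
      by (intro wiener_limit_add[OF bm] wiener_limit_scale[OF bm] wiener_increment_limit[OF bm X]) auto
    \<comment> \<open>\<open>t \<le> s'\<close> makes the two intervals disjoint, so the square has
      no cross term.\<close>
    have sq: "(?f u)\<^sup>2 = a\<^sup>2 * (indicator {s<..t} u * (\<sigma> u)\<^sup>2) + b\<^sup>2 * (indicator {s'<..t'} u * (\<sigma> u)\<^sup>2)" for u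
      using st that by (auto simp: indicator_def power_mult_distrib)
    have "integrable lborel (\<lambda>u. (?f u)\<^sup>2)"
      unfolding sq using st that by (intro Bochner_Integration.integrable_add integrable_mult_right int') auto
    moreover have "(LINT u|lborel. (?f u)\<^sup>2) = a\<^sup>2 * v s t + b\<^sup>2 * v s' t'"
      unfolding sq v[symmetric] using int' st that by (subst Bochner_Integration.integral_add) auto
    ultimately show ?thesis using wiener_limit_char[OF bm wl] by simp
  qed
  have D[measurable]: "D s t \<in> borel_measurable M"
    unfolding D_def using st by (intro borel_measurable_diff meas) auto
  \<comment> \<open>A single increment is the pair case with coefficient 0 on the degenerate
    interval from 1 to 1.\<close>
  have "char (distr M borel (D s t)) x = complex_of_real (exp (- (v s t * x\<^sup>2) / 2))" for x
    using char[of 1 1 1 0 x] st by simp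
  from gaussian_moments[OF D v0 this]
  show "integrable M (\<lambda>\<omega>. (D s t \<omega>)^2)" "(LINT \<omega>|M. (D s t \<omega>)^2) = v s t"
    "integrable M (\<lambda>\<omega>. (D s t \<omega>)^4)" "(LINT \<omega>|M. (D s t \<omega>)^4) = 3 * (v s t)\<^sup>2"
    by auto
  assume *: "t \<le> s'" "s' \<le> t'" "t' \<le> 1"
  have D'[measurable]: "D s' t' \<in> borel_measurable M"
    unfolding D_def using st * by (intro borel_measurable_diff meas) auto
  from gaussian_pair_moments[OF D D' v0 v0 char[OF *]]
  show "integrable M (\<lambda>\<omega>. (D s t \<omega>)\<^sup>2 * (D s' t' \<omega>)\<^sup>2)"
    "(LINT \<omega>|M. (D s t \<omega>)\<^sup>2 * (D s' t' \<omega>)\<^sup>2) = v s t * v s' t'"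
    by auto
qed

text \<open>Expanding the product leaves \<open>E[D_i^2 D_j^2] / (v_i v_j) - 1\<close>. The ratio is
  3 for \<open>i = j\<close>, from the normal fourth moment, and 1 otherwise.\<close>

lemma wiener_squares_uncorrelated:
  assumes bm: "standard_brownian_motion M W"
    and X: "\<forall>t\<in>{0..1}. has_wiener_integral M W \<sigma> t (X t)"
    and int: "set_integrable lborel {0..1} (\<lambda>u. (\<sigma> u)\<^sup>2)"
    and p: "is_partition 0 1 n p"
  defines "v \<equiv> (\<lambda>i. LINT u:{p (i - 1)<..p i}|lborel. (\<sigma> u)\<^sup>2)"
  defines "u \<equiv> (\<lambda>i \<omega>. (X (p i) \<omega> - X (p (i - 1)) \<omega>)\<^sup>2 / v i - 1)"
  assumes pos: "\<And>i. i \<in> {1..n} \<Longrightarrow> 0 < v i"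
    and ij: "i \<in> {1..n}" "j \<in> {1..n}"
  shows "has_bochner_integral M (\<lambda>\<omega>. u i \<omega> * u j \<omega>) (if i = j then 2 else 0)"
proof -
  interpret prob_space M using bm by (simp add: standard_brownian_motion_def)
  define D where "D i \<omega> = X (p i) \<omega> - X (p (i - 1)) \<omega>" for i \<omega>
  have pr: "0 \<le> p i" "p i \<le> 1" if "i \<le> n" for i
    using partition_mono[OF p, of 0 i] partition_mono[OF p, of i n] p that
    by (auto simp: is_partition_def)
  have pm: "p (i - 1) \<le> p i" if "i \<in> {1..n}" for i
    using partition_mono[OF p, of "i - 1" i] that by auto
  have m: "has_bochner_integral M (\<lambda>\<omega>. (D i \<omega>)^2) (v i)"
    "has_bochner_integral M (\<lambda>\<omega>. (D i \<omega>)^4) (3 * (v i)\<^sup>2)" if "i \<in> {1..n}" for i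
    using wiener_increment_moments(1-4)[OF bm X int, of "p (i - 1)" "p i"] pr[of i] pr[of "i - 1"] pm that
    by (auto simp: has_bochner_integral_iff D_def v_def)
  have lt: "has_bochner_integral M (\<lambda>\<omega>. (D i \<omega>)\<^sup>2 * (D j \<omega>)\<^sup>2) (v i * v j)"
    if "i \<in> {1..n}" "j \<in> {1..n}" "i < j" for i j
    using wiener_increment_moments(5-6)[OF bm X int, of "p (i - 1)" "p i" "p (j - 1)" "p j"]
      partition_mono[OF p, of i "j - 1"]  pr[of i] pr[of "i - 1"] pr[of j] pm that
    by (auto simp: has_bochner_integral_iff D_def v_def)
  have main: "has_bochner_integral M (\<lambda>\<omega>. (D i \<omega>)\<^sup>2 * (D j \<omega>)\<^sup>2) (v i * v j * (if i = j then 3 else 1))"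
  proof -
    consider "i < j" | "j < i" | "i = j" by linarith
    then show ?thesis
    proof cases
      case 1
      then show ?thesis using lt[OF ij 1] by simp
    next
      case 2
      then show ?thesis using lt[OF ij(2,1) 2] by (simp add: mult.commute)
    next
      case 3
      have "(\<lambda>\<omega>. (D j \<omega>)\<^sup>2 * (D j \<omega>)\<^sup>2) = (\<lambda>\<omega>. (D j \<omega>)^4)"
        by (simp add: power_add[symmetric])
      then show ?thesis using 3 m(2)[OF ij(2)] by (simp add: power2_eq_square mult_ac)
    qed
  qed
  have eq: "u i \<omega> * u j \<omega> = (D i \<omega>)\<^sup>2 * (D j \<omega>)\<^sup>2 / (v i * v j) - (D i \<omega>)\<^sup>2 / v i - (D j \<omega>)\<^sup>2 / v j + 1" for \<omega>
    by (simp add: u_def D_def algebra_simps)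
  have "has_bochner_integral M (\<lambda>\<omega>. (D i \<omega>)\<^sup>2 * (D j \<omega>)\<^sup>2 / (v i * v j) - (D i \<omega>)\<^sup>2 / v i - (D j \<omega>)\<^sup>2 / v j + 1)
     (v i * v j * (if i = j then 3 else 1) / (v i * v j) - v i / v i - v j / v j + 1)"
    by (intro has_bochner_integral_add has_bochner_integral_diff has_bochner_integral_divide_zero
      main m ij) (simp add: has_bochner_integral_iff prob_space)
  also have "v i * v j * (if i = j then 3 else 1) / (v i * v j) - v i / v i - v j / v j + 1 = (if i = j then 2 else 0)"
    using pos[OF ij(1)] pos[OF ij(2)] by simp
  finally show ?thesis unfolding eq .
qed

text \<open>The bounded quantity is what summation by parts produces. It averages the partial sums
  instead of maximising over them, so bounds on each \<open>S m\<close> separately suffice: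
  orthogonality gives the second moment \<open>2 m\<close>, and Markov's inequality is applied to a
  first moment of order \<open>sqrt n\<close>.\<close>

lemma (in prob_space) partial_sums_tail:
  fixes u :: "nat \<Rightarrow> 'a \<Rightarrow> real" and n :: nat and \<eta> :: real
  assumes meas: "\<And>i. i \<in> {1..n} \<Longrightarrow> u i \<in> borel_measurable M"
    and cov: "\<And>i j. i \<in> {1..n} \<Longrightarrow> j \<in> {1..n} \<Longrightarrow>
      has_bochner_integral M (\<lambda>\<omega>. u i \<omega> * u j \<omega>) (if i = j then 2 else 0)"
    and n: "0 < n" and \<eta>: "0 < \<eta>"
  shows "prob {\<omega>\<in>space M. \<eta> * n \<le> \<bar>\<Sum>i=1..n. u i \<omega>\<bar> + (\<Sum>m<n. \<bar>\<Sum>i=1..m. u i \<omega>\<bar>) / n}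
    \<le> 3 / (\<eta> * sqrt n)"
proof -
  define S where "S m \<omega> = (\<Sum>i=1..m. u i \<omega>)" for m \<omega>
  define T where "T \<omega> = \<bar>S n \<omega>\<bar> + (\<Sum>m<n. \<bar>S m \<omega>\<bar>) / n" for \<omega>
  \<comment> \<open>Integrable majorant of \<open>T\<close>, from applying \<open>young\<close> to
    every \<open>\<bar>S m\<bar>\<close>. Its weight \<open>sqrt n\<close> balances the two terms,
    as \<open>(S m)^2\<close> is of order at most \<open>n\<close>. The mean of \<open>G\<close> is
    at most \<open>2 sqrt n + sqrt n\<close>, hence the 3 in the claim.\<close>
  define G where "G \<omega> = ((S n \<omega>)\<^sup>2 + (\<Sum>m<n. (S m \<omega>)\<^sup>2) / n) / (2 * sqrt n) + sqrt n" for \<omega>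
  have S[measurable]: "S m \<in> borel_measurable M" if "m \<le> n" for m
    unfolding S_def[abs_def] using that by (intro borel_measurable_sum meas) auto
  have T[measurable]: "T \<in> borel_measurable M" unfolding T_def[abs_def] by measurable
  have S2: "has_bochner_integral M (\<lambda>\<omega>. (S m \<omega>)\<^sup>2) (2 * real m)" if "m \<le> n" for m
  proof -
    have "has_bochner_integral M (\<lambda>\<omega>. \<Sum>i=1..m. \<Sum>j=1..m. u i \<omega> * u j \<omega>)
       (\<Sum>i=1..m. \<Sum>j=1..m. if i = j then 2 else 0)"
      using that by (intro has_bochner_integral_sum cov) auto
    then show ?thesis by (simp add: S_def power2_eq_square sum_product mult.commute)
  qed
  have G: "has_bochner_integral M G ((2 * n + (\<Sum>m<n. 2 * real m) / n) / (2 * sqrt n) + sqrt n)"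
    unfolding G_def[abs_def]
    by (intro has_bochner_integral_add has_bochner_integral_divide_zero has_bochner_integral_sum S2)
      (use S2[of n] in \<open>auto simp: has_bochner_integral_iff prob_space\<close>)
  have young: "\<bar>x\<bar> \<le> x\<^sup>2 / (2 * sqrt n) + sqrt n / 2" for x :: real
  proof -
    have "0 \<le> (\<bar>x\<bar> - sqrt n)\<^sup>2" by simp
    also have "\<dots> = x\<^sup>2 + sqrt n * sqrt n - 2 * sqrt n * \<bar>x\<bar>" by (simp add: power2_diff)
    finally have "2 * sqrt n * \<bar>x\<bar> \<le> x\<^sup>2 + sqrt n * sqrt n" by simp
    then show ?thesis using n by (simp add: field_simps)
  qed
  have TG: "T \<omega> \<le> G \<omega>" for \<omega>
  proof -
    have "(\<Sum>m<n. \<bar>S m \<omega>\<bar>) \<le> (\<Sum>m<n. (S m \<omega>)\<^sup>2 / (2 * sqrt n) + sqrt n / 2)"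
      by (intro sum_mono young)
    also have "\<dots> = (\<Sum>m<n. (S m \<omega>)\<^sup>2) / (2 * sqrt n) + n * (sqrt n / 2)"
      by (simp add: sum.distrib sum_divide_distrib)
    finally have "(\<Sum>m<n. \<bar>S m \<omega>\<bar>) / n \<le> ((\<Sum>m<n. (S m \<omega>)\<^sup>2) / (2 * sqrt n) + n * (sqrt n / 2)) / n"
      by (rule divide_right_mono) simp
    also have "\<dots> = (\<Sum>m<n. (S m \<omega>)\<^sup>2) / n / (2 * sqrt n) + sqrt n / 2"
      using n by (simp add: add_divide_distrib)
    finally show ?thesis
      unfolding T_def G_def using young[of "S n \<omega>"] by (simp add: add_divide_distrib)
  qed
  have T0: "0 \<le> T \<omega>" for \<omega> unfolding T_def by (intro add_nonneg_nonneg divide_nonneg_nonneg sum_nonneg) auto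
  have intT: "integrable M T"
    by (rule Bochner_Integration.integrable_bound[of _ G])
      (use G TG T0 in \<open>auto simp: has_bochner_integral_iff intro!: order_trans[OF TG]\<close>)
  have "(\<Sum>m<n. 2 * real m) \<le> (\<Sum>m<n. 2 * real n)" by (intro sum_mono) auto
  then have "(\<Sum>m<n. 2 * real m) / n \<le> 2 * n" using n by (simp add: field_simps)
  then have "(2 * n + (\<Sum>m<n. 2 * real m) / n) / (2 * sqrt n) \<le> (4 * n) / (2 * sqrt n)"
    by (intro divide_right_mono) auto
  also have "\<dots> = 2 * (n / sqrt n)" by simp
  also have "\<dots> = 2 * sqrt n" by (subst real_div_sqrt) auto
  finally have ET: "expectation T \<le> 3 * sqrt n"
    using integral_mono[OF intT _ TG] G by (auto simp: has_bochner_integral_iff)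
  have "prob {\<omega>\<in>space M. \<eta> * n \<le> T \<omega>} \<le> expectation T / (\<eta> * n)"
    using n \<eta> T0 by (intro integral_Markov_inequality_measure[OF intT sets.top]) auto
  also have "\<dots> \<le> 3 * sqrt n / (\<eta> * n)"
    using n \<eta> ET by (intro divide_right_mono) auto
  also have "\<dots> = 3 / (\<eta> * sqrt n)"
    using n \<eta> by (simp add: field_simps)
  finally show ?thesis unfolding T_def S_def .
qed

section \<open>Likelihood ratios\<close>

lemma sum_by_parts:
  fixes u a :: "nat \<Rightarrow> real"
  shows "(\<Sum>i=1..n. u i * a i)
    = (\<Sum>i=1..n. u i) * a n - (\<Sum>m<n. (\<Sum>i=1..m. u i) * (a (Suc m) - a m))"
  by (induction n) (auto simp: algebra_simps)

text \<open>The step bound is required only for \<open>0 < m\<close>, since for \<open>m = 0\<close>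
  the other factor is an empty partial sum. This matters because index 0 would stand for a
  degenerate observation interval.\<close>

lemma abs_sum_by_parts_le:
  fixes u a :: "nat \<Rightarrow> real"
  assumes last: "0 < n \<Longrightarrow> \<bar>a n\<bar> \<le> C" and step: "\<And>m. 0 < m \<Longrightarrow> m < n \<Longrightarrow> \<bar>a (Suc m) - a m\<bar> \<le> C / n"
  shows "\<bar>\<Sum>i=1..n. u i * a i\<bar> \<le> C * (\<bar>\<Sum>i=1..n. u i\<bar> + (\<Sum>m<n. \<bar>\<Sum>i=1..m. u i\<bar>) / n)"
proof -
  have "\<bar>(\<Sum>i=1..m. u i) * (a (Suc m) - a m)\<bar> \<le> \<bar>\<Sum>i=1..m. u i\<bar> * (C / n)" if "m < n" for m
    using step[of m] that mult_left_mono[of "\<bar>a (Suc m) - a m\<bar>" "C / n" "\<bar>\<Sum>i=1..m. u i\<bar>"]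
    by (cases "m = 0") (auto simp: abs_mult)
  then have "\<bar>\<Sum>m<n. (\<Sum>i=1..m. u i) * (a (Suc m) - a m)\<bar> \<le> (\<Sum>m<n. \<bar>\<Sum>i=1..m. u i\<bar> * (C / n))"
    by (intro order_trans[OF sum_abs] sum_mono) auto
  moreover have "\<bar>(\<Sum>i=1..n. u i) * a n\<bar> \<le> \<bar>\<Sum>i=1..n. u i\<bar> * C"
    using last by (cases "n = 0") (auto simp: abs_mult intro!: mult_left_mono)
  ultimately show ?thesis
    unfolding sum_by_parts sum_distrib_right[symmetric] by (simp add: algebra_simps)
qed

lemma diff_ln_ge:
  fixes r :: real
  assumes "0 < r" "r \<le> b\<^sup>2" "0 \<le> b"
  shows "(r - 1)\<^sup>2 / (b + 1)\<^sup>2 \<le> r - 1 - ln r"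
proof -
  \<comment> \<open>\<open>ln r = 2 ln (sqrt r) \<le> 2 (sqrt r - 1)\<close> turns the right-hand side into a square\<close>
  have s: "0 < sqrt r" "sqrt r \<le> b" using assms real_le_lsqrt by auto
  have "ln r = 2 * ln (sqrt r)" using assms(1) by (simp add: ln_sqrt)
  also have "\<dots> \<le> 2 * (sqrt r - 1)" using ln_le_minus_one[OF s(1)] by simp
  finally have "r - 1 - 2 * (sqrt r - 1) \<le> r - 1 - ln r" by simp
  moreover have "r - 1 - 2 * (sqrt r - 1) = (sqrt r - 1)\<^sup>2"
    using assms(1) by (simp add: power2_diff)
  moreover have "(r - 1)\<^sup>2 = (sqrt r - 1)\<^sup>2 * (sqrt r + 1)\<^sup>2"
  proof -
    have "r - 1 = (sqrt r - 1) * (sqrt r + 1)" using assms(1) by (simp add: algebra_simps)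
    then show ?thesis by (metis power_mult_distrib)
  qed
  then have "(r - 1)\<^sup>2 \<le> (sqrt r - 1)\<^sup>2 * (b + 1)\<^sup>2"
    using s by (auto intro!: mult_left_mono power_mono)
  then have "(r - 1)\<^sup>2 / (b + 1)\<^sup>2 \<le> (sqrt r - 1)\<^sup>2"
    using assms(3) by (simp add: divide_le_eq)
  ultimately show ?thesis by linarith
qed

lemma diff_ln_le:
  fixes r :: real
  assumes "0 < r"
  shows "r - 1 - ln r \<le> (r - 1)\<^sup>2 / r"
proof -
  have "- ln r = ln (1 / r)" using assms by (simp add: ln_div)
  also have "\<dots> \<le> 1 / r - 1" using assms by (intro ln_le_minus_one) auto
  finally have "r - 1 - ln r \<le> r - 1 + (1 / r - 1)" by simp
  also have "\<dots> = (r - 1)\<^sup>2 / r" using assms by (simp add: power2_eq_square field_simps)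
  finally show ?thesis .
qed

section \<open>Increment variances of Lipschitz volatilities\<close>

lemma set_integral_Icc_bounds:
  fixes f :: "real \<Rightarrow> real"
  assumes f: "set_integrable lborel {a..b} f" and "a \<le> b"
    and bd: "\<And>u. u \<in> {a..b} \<Longrightarrow> c \<le> f u" "\<And>u. u \<in> {a..b} \<Longrightarrow> f u \<le> d"
  shows "c * (b - a) \<le> (LINT u:{a..b}|lborel. f u)" "(LINT u:{a..b}|lborel. f u) \<le> d * (b - a)"
proof -
  have const: "set_integrable lborel {a..b} (\<lambda>_. k)" "(LINT u:{a..b}|lborel. k) = k * (b - a)" for k :: real
    using \<open>a \<le> b\<close> by (auto simp: set_integrable_def set_lebesgue_integral_def mult.commute)
  show "c * (b - a) \<le> (LINT u:{a..b}|lborel. f u)"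
    unfolding const(2)[symmetric] by (intro set_integral_mono const f bd)
  show "(LINT u:{a..b}|lborel. f u) \<le> d * (b - a)"
    unfolding const(2)[symmetric] by (intro set_integral_mono const f bd)
qed

lemma obs_time_le: "i \<le> j \<Longrightarrow> obs_time n i \<le> obs_time n j"
  by (simp add: obs_time_def divide_right_mono)

text \<open>This includes \<open>n = 0\<close>, where division by zero yields 0; measurability of
  the posterior is later claimed for every \<open>n\<close>.\<close>

lemma obs_time_in: "i \<le> n \<Longrightarrow> obs_time n i \<in> {0..1}"
  by (cases "n = 0") (auto simp: obs_time_def)

lemma obs_time_diff: "1 \<le> i \<Longrightarrow> obs_time n i - obs_time n (i - 1) = 1 / n"
  by (simp add: obs_time_def of_nat_diff diff_divide_distrib[symmetric])

lemma obs_interval_subset: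
  assumes "i \<in> {1..n}"
  shows "{obs_time n (i - 1)..obs_time n i} \<subseteq> {0..1}"
  using obs_time_in[of "i - 1" n] obs_time_in[of i n] assms by auto

text \<open>Neighbouring closed intervals share an end point. The gauge integral combines them
  directly, and for continuous \<open>f\<close> it agrees with the Lebesgue integral.\<close>

lemma set_integral_obs_split:
  fixes f :: "real \<Rightarrow> real"
  assumes f: "continuous_on {0..1} f" and n: "0 < n"
  shows "(LINT u:{0..1}|lborel. f u) = (\<Sum>i=1..n. LINT u:{obs_time n (i - 1)..obs_time n i}|lborel. f u)"
proof -
  have sub: "continuous_on {a..b} f" if "0 \<le> a" "b \<le> 1" for a b
    by (rule continuous_on_subset[OF f]) (use that in auto)
  have eq: "(LINT u:{a..b}|lborel. f u) = integral {a..b} f" if "0 \<le> a" "b \<le> 1" for a b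
    by (intro set_borel_integral_eq_integral borel_integrable_atLeastAtMost' sub that)
  have "integral {0..obs_time n m} f = (\<Sum>i=1..m. integral {obs_time n (i - 1)..obs_time n i} f)"
    if "m \<le> n" for m
    using that
  proof (induction m)
    case 0
    then show ?case by (simp add: obs_time_def)
  next
    case (Suc m)
    have "integral {0..obs_time n (Suc m)} f
      = integral {0..obs_time n m} f + integral {obs_time n m..obs_time n (Suc m)} f"
      using obs_time_in[of m n] obs_time_in[of "Suc m" n] obs_time_le[of m "Suc m" n] Suc.prems
      by (intro Henstock_Kurzweil_Integration.integral_combine[symmetric] integrable_continuous_interval sub) auto
    then show ?case using Suc by simp
  qed
  from this[of n] have "integral {0..1} f = (\<Sum>i=1..n. integral {obs_time n (i - 1)..obs_time n i} f)"
    using n by (simp add: obs_time_def)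
  also have "\<dots> = (\<Sum>i=1..n. LINT u:{obs_time n (i - 1)..obs_time n i}|lborel. f u)"
  proof (intro sum.cong refl eq[symmetric])
    fix i assume "i \<in> {1..n}"
    then show "0 \<le> obs_time n (i - 1)" "obs_time n i \<le> 1"
      using obs_time_in[of "i - 1" n] obs_time_in[of i n] by auto
  qed
  finally show ?thesis by (simp add: eq)
qed

locale lipschitz_bounds =
  fixes \<kappa> K M :: real
  assumes \<kappa>: "0 < \<kappa>" "\<kappa> < K" and M: "0 < M"
begin

abbreviation "\<X> \<equiv> lipschitz_class \<kappa> K M"

lemma class_bounds:
  assumes "\<sigma> \<in> \<X>" "t \<in> {0..1}"
  shows "\<kappa> \<le> \<sigma> t" "\<sigma> t \<le> K" "0 < \<sigma> t"
proof -
  have "\<sigma> t \<in> {\<kappa>..K}" using assms by (auto simp: lipschitz_class_def)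
  then show "\<kappa> \<le> \<sigma> t" "\<sigma> t \<le> K" "0 < \<sigma> t" using \<kappa> by auto
qed

lemma class_lipschitz:
  assumes "\<sigma> \<in> \<X>" "s \<in> {0..1}" "t \<in> {0..1}"
  shows "\<bar>\<sigma> s - \<sigma> t\<bar> \<le> M * \<bar>s - t\<bar>"
  using assms by (auto simp: lipschitz_class_def dist_real_def dest: lipschitz_onD)

lemma class_continuous: "\<sigma> \<in> \<X> \<Longrightarrow> continuous_on {0..1} \<sigma>"
  by (auto simp: lipschitz_class_def intro: lipschitz_on_continuous_on)

lemma square_diff_le:
  fixes x y :: real
  assumes "0 \<le> x" "x \<le> K" "0 \<le> y" "y \<le> K"
  shows "\<bar>x\<^sup>2 - y\<^sup>2\<bar> \<le> 2 * K * \<bar>x - y\<bar>"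
proof -
  have "\<bar>x\<^sup>2 - y\<^sup>2\<bar> = (x + y) * \<bar>x - y\<bar>"
    using assms by (simp add: power2_eq_square square_diff_square_factored abs_mult)
  also have "\<dots> \<le> (2 * K) * \<bar>x - y\<bar>" using assms by (intro mult_right_mono) auto
  finally show ?thesis .
qed

lemma class_set_integrable:
  assumes "\<sigma> \<in> \<X>" "i \<in> {1..n}"
  shows "set_integrable lborel {obs_time n (i - 1)..obs_time n i} (\<lambda>u. (\<sigma> u)\<^sup>2)"
  by (intro borel_integrable_atLeastAtMost' continuous_on_power continuous_on_subset[OF class_continuous]
      obs_interval_subset assms)

text \<open>Times \<open>n\<close>, an increment variance is the average of
  \<open>\<sigma>^2\<close> over an interval of length \<open>1 / n\<close>; in this scale the
  bounds are uniform in \<open>n\<close> and \<open>i\<close>.\<close>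

lemma increment_variance_between:
  assumes \<sigma>: "\<sigma> \<in> \<X>" and i: "i \<in> {1..n}"
    and bd: "\<And>u. u \<in> {obs_time n (i - 1)..obs_time n i} \<Longrightarrow> c \<le> (\<sigma> u)\<^sup>2 \<and> (\<sigma> u)\<^sup>2 \<le> d"
  shows "c \<le> n * increment_variance n \<sigma> i" "n * increment_variance n \<sigma> i \<le> d"
proof -
  have n: "0 < n" using i by auto
  have le: "obs_time n (i - 1) \<le> obs_time n i" by (rule obs_time_le) simp
  have 1: "1 \<le> i" using i by auto
  have "c * (1 / n) \<le> increment_variance n \<sigma> i \<and> increment_variance n \<sigma> i \<le> d * (1 / n)"
    unfolding increment_variance_def obs_time_diff[OF 1, symmetric]
    using set_integral_Icc_bounds[OF class_set_integrable[OF \<sigma> i] le, of c d] bd by blast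
  then show "c \<le> n * increment_variance n \<sigma> i" "n * increment_variance n \<sigma> i \<le> d"
    using n by (auto simp: field_simps)
qed

lemma increment_variance_bounds:
  assumes \<sigma>: "\<sigma> \<in> \<X>" and i: "i \<in> {1..n}"
  shows "\<kappa>\<^sup>2 \<le> n * increment_variance n \<sigma> i" "n * increment_variance n \<sigma> i \<le> K\<^sup>2"
    "0 < increment_variance n \<sigma> i"
proof -
  have "\<kappa>\<^sup>2 \<le> (\<sigma> u)\<^sup>2 \<and> (\<sigma> u)\<^sup>2 \<le> K\<^sup>2" if "u \<in> {obs_time n (i - 1)..obs_time n i}" for u
    using class_bounds[OF \<sigma>, of u] obs_interval_subset[OF i] that \<kappa> by (auto intro!: power_mono)
  note b = increment_variance_between[OF \<sigma> i this]
  show "\<kappa>\<^sup>2 \<le> n * increment_variance n \<sigma> i" "n * increment_variance n \<sigma> i \<le> K\<^sup>2" using b by auto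
  have "0 < n * increment_variance n \<sigma> i" using b(1) \<kappa> by (auto intro: less_le_trans[of 0 "\<kappa>\<^sup>2"])
  then show "0 < increment_variance n \<sigma> i" by (simp add: zero_less_mult_iff)
qed

text \<open>\<open>\<sigma>^2\<close> is Lipschitz with constant \<open>2 K M\<close>, and the
  interval has length \<open>1 / n\<close>.\<close>

lemma increment_variance_approx:
  assumes \<sigma>: "\<sigma> \<in> \<X>" and i: "i \<in> {1..n}" and t: "t \<in> {obs_time n (i - 1)..obs_time n i}"
  shows "\<bar>n * increment_variance n \<sigma> i - (\<sigma> t)\<^sup>2\<bar> \<le> 2 * K * M / n"
proof -
  have sub: "u \<in> {0..1}" if "u \<in> {obs_time n (i - 1)..obs_time n i}" for u
    using obs_interval_subset[OF i] that by auto
  have "\<bar>(\<sigma> u)\<^sup>2 - (\<sigma> t)\<^sup>2\<bar> \<le> 2 * K * M / n" if u: "u \<in> {obs_time n (i - 1)..obs_time n i}" for u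
  proof -
    have 1: "1 \<le> i" using i by auto
    have "\<bar>u - t\<bar> \<le> obs_time n i - obs_time n (i - 1)" using u t by auto
    then have d: "\<bar>u - t\<bar> \<le> 1 / n" unfolding obs_time_diff[OF 1] .
    have "\<bar>(\<sigma> u)\<^sup>2 - (\<sigma> t)\<^sup>2\<bar> \<le> 2 * K * \<bar>\<sigma> u - \<sigma> t\<bar>"
      using class_bounds[OF \<sigma> sub[OF u]] class_bounds[OF \<sigma> sub[OF t]]
      by (intro square_diff_le) auto
    also have "\<dots> \<le> 2 * K * (M * (1 / n))"
    proof (rule mult_left_mono)
      have "M * \<bar>u - t\<bar> \<le> M * (1 / n)" using d M by (intro mult_left_mono) auto
      with class_lipschitz[OF \<sigma> sub[OF u] sub[OF t]] show "\<bar>\<sigma> u - \<sigma> t\<bar> \<le> M * (1 / n)" by linarith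
    qed (use \<kappa> in auto)
    finally show ?thesis by simp
  qed
  then have "(\<sigma> t)\<^sup>2 - 2 * K * M / n \<le> (\<sigma> u)\<^sup>2 \<and> (\<sigma> u)\<^sup>2 \<le> (\<sigma> t)\<^sup>2 + 2 * K * M / n"
    if "u \<in> {obs_time n (i - 1)..obs_time n i}" for u
    using that by (force simp: abs_le_iff)
  from increment_variance_between[OF \<sigma> i this] show ?thesis by (simp add: abs_le_iff)
qed

lemma increment_variance_close:
  assumes \<sigma>: "\<sigma> \<in> \<X>" "\<tau> \<in> \<X>" and i: "i \<in> {1..n}"
    and close: "\<And>t. t \<in> {0..1} \<Longrightarrow> \<bar>\<sigma> t - \<tau> t\<bar> \<le> \<delta>"
  shows "\<bar>n * increment_variance n \<sigma> i - n * increment_variance n \<tau> i\<bar> \<le> 2 * K * \<delta>"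
proof -
  have 1: "1 \<le> i" and n: "0 < n" using i by auto
  have sub: "u \<in> {0..1}" if "u \<in> {obs_time n (i - 1)..obs_time n i}" for u
    using obs_interval_subset[OF i] that by auto
  have *: "\<bar>(\<sigma> u)\<^sup>2 - (\<tau> u)\<^sup>2\<bar> \<le> 2 * K * \<delta>" if "u \<in> {obs_time n (i - 1)..obs_time n i}" for u
  proof -
    have "\<bar>(\<sigma> u)\<^sup>2 - (\<tau> u)\<^sup>2\<bar> \<le> 2 * K * \<bar>\<sigma> u - \<tau> u\<bar>"
      using class_bounds[OF \<sigma>(1) sub[OF that]] class_bounds[OF \<sigma>(2) sub[OF that]]
      by (intro square_diff_le) auto
    also have "\<dots> \<le> 2 * K * \<delta>" using close[OF sub[OF that]] \<kappa> by (intro mult_left_mono) auto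
    finally show ?thesis .
  qed
  have le: "obs_time n (i - 1) \<le> obs_time n i" by (rule obs_time_le) simp
  note int = class_set_integrable[OF \<sigma>(1) i] class_set_integrable[OF \<sigma>(2) i]
  have eq: "increment_variance n \<sigma> i - increment_variance n \<tau> i
    = (LINT u:{obs_time n (i - 1)..obs_time n i}|lborel. (\<sigma> u)\<^sup>2 - (\<tau> u)\<^sup>2)"
    unfolding increment_variance_def by (rule set_integral_diff(2)[OF int, symmetric])
  have "- (2 * K * \<delta>) * (1 / n) \<le> increment_variance n \<sigma> i - increment_variance n \<tau> i
    \<and> increment_variance n \<sigma> i - increment_variance n \<tau> i \<le> 2 * K * \<delta> * (1 / n)"
    unfolding eq obs_time_diff[OF 1, symmetric]
  proof
    show "- (2 * K * \<delta>) * (obs_time n i - obs_time n (i - 1))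
      \<le> (LINT u:{obs_time n (i - 1)..obs_time n i}|lborel. (\<sigma> u)\<^sup>2 - (\<tau> u)\<^sup>2)"
      by (rule set_integral_Icc_bounds(1)[OF set_integral_diff(1)[OF int] le, where d = "2 * K * \<delta>"])
        (use * in \<open>force simp: abs_le_iff\<close>)+
    show "(LINT u:{obs_time n (i - 1)..obs_time n i}|lborel. (\<sigma> u)\<^sup>2 - (\<tau> u)\<^sup>2)
      \<le> 2 * K * \<delta> * (obs_time n i - obs_time n (i - 1))"
      by (rule set_integral_Icc_bounds(2)[OF set_integral_diff(1)[OF int] le, where c = "- (2 * K * \<delta>)"])
        (use * in \<open>force simp: abs_le_iff\<close>)+
  qed
  then show ?thesis using n by (auto simp: abs_le_iff field_simps)
qed

text \<open>The averages see \<open>\<sigma>^2 - \<tau>^2\<close>, whose modulus is at least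
  \<open>2 \<kappa> \<bar>\<sigma> - \<tau>\<bar>\<close>, whence the factor
  \<open>4 \<kappa>^2\<close>. The last term pays for replacing values by averages.\<close>

lemma L2_dist_le:
  assumes \<sigma>: "\<sigma> \<in> \<X>" "\<tau> \<in> \<X>" and n: "0 < n"
  shows "4 * \<kappa>\<^sup>2 * (LINT t:{0..1}|lborel. (\<sigma> t - \<tau> t)\<^sup>2)
    \<le> (\<Sum>i=1..n. (n * increment_variance n \<sigma> i - n * increment_variance n \<tau> i)\<^sup>2) / n + 8 * K^3 * M / n"
proof -
  define d where "d i = n * increment_variance n \<sigma> i - n * increment_variance n \<tau> i" for i
  have cont: "continuous_on {0..1} (\<lambda>t. (\<sigma> t - \<tau> t)\<^sup>2)"
    by (intro continuous_intros class_continuous \<sigma>)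
  have piece: "4 * \<kappa>\<^sup>2 * (LINT t:{obs_time n (i - 1)..obs_time n i}|lborel. (\<sigma> t - \<tau> t)\<^sup>2)
      \<le> ((d i)\<^sup>2 + 8 * K^3 * M / n) / n" if i: "i \<in> {1..n}" for i
  proof -
    have 1: "1 \<le> i" using i by auto
    have le: "obs_time n (i - 1) \<le> obs_time n i" by (rule obs_time_le) simp
    have pt: "(\<sigma> t - \<tau> t)\<^sup>2 \<le> ((d i)\<^sup>2 + 8 * K^3 * M / n) / (4 * \<kappa>\<^sup>2)"
      if t: "t \<in> {obs_time n (i - 1)..obs_time n i}" for t
    proof -
      have t01: "t \<in> {0..1}" using obs_interval_subset[OF i] t by auto
      note b = class_bounds[OF \<sigma>(1) t01] class_bounds[OF \<sigma>(2) t01]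
      define e where "e = (\<sigma> t)\<^sup>2 - (\<tau> t)\<^sup>2"
      have "4 * \<kappa>\<^sup>2 * (\<sigma> t - \<tau> t)\<^sup>2 = (2 * \<kappa>)\<^sup>2 * (\<sigma> t - \<tau> t)\<^sup>2" by (simp add: power_mult_distrib)
      also have "\<dots> \<le> (\<sigma> t + \<tau> t)\<^sup>2 * (\<sigma> t - \<tau> t)\<^sup>2"
        using b \<kappa> by (intro mult_right_mono power_mono) auto
      also have "\<dots> = e\<^sup>2" by (simp add: e_def power2_eq_square algebra_simps)
      finally have 1: "4 * \<kappa>\<^sup>2 * (\<sigma> t - \<tau> t)\<^sup>2 \<le> e\<^sup>2" .
      \<comment> \<open>\<open>e^2 - (d i)^2\<close> factors into \<open>e - d i\<close>, of order
        \<open>1 / n\<close>, and the bounded \<open>e + d i\<close>; the constant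
        \<open>8 K^3 M\<close> is \<open>4 K M\<close> times \<open>2 K^2\<close>.\<close>
      have "\<bar>e - d i\<bar> \<le> 4 * K * M / n"
        using increment_variance_approx[OF \<sigma>(1) i t] increment_variance_approx[OF \<sigma>(2) i t]
        unfolding e_def d_def by (simp add: abs_le_iff)
      moreover have "\<bar>e + d i\<bar> \<le> 2 * K\<^sup>2"
      proof -
        have "\<bar>e\<bar> \<le> K\<^sup>2"
        proof -
          have "0 \<le> (\<sigma> t)\<^sup>2" "(\<sigma> t)\<^sup>2 \<le> K\<^sup>2" "0 \<le> (\<tau> t)\<^sup>2" "(\<tau> t)\<^sup>2 \<le> K\<^sup>2"
            using b by (auto intro!: power_mono)
          then show ?thesis unfolding e_def by linarith
        qed
        moreover have "\<bar>d i\<bar> \<le> K\<^sup>2"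
          using increment_variance_bounds[OF \<sigma>(1) i] increment_variance_bounds[OF \<sigma>(2) i]
            zero_le_power2[of \<kappa>] unfolding d_def by linarith
        ultimately show ?thesis by linarith
      qed
      ultimately have "\<bar>e - d i\<bar> * \<bar>e + d i\<bar> \<le> (4 * K * M / n) * (2 * K\<^sup>2)"
        using \<kappa> M by (intro mult_mono) auto
      moreover have "e\<^sup>2 - (d i)\<^sup>2 \<le> \<bar>e - d i\<bar> * \<bar>e + d i\<bar>"
      proof -
        have "e\<^sup>2 - (d i)\<^sup>2 = (e - d i) * (e + d i)" by (simp add: power2_eq_square algebra_simps)
        then show ?thesis by (metis abs_ge_self abs_mult)
      qed
      ultimately have "e\<^sup>2 \<le> (d i)\<^sup>2 + 8 * K^3 * M / n"
        by (simp add: power2_eq_square power3_eq_cube mult_ac)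
      with 1 have "4 * \<kappa>\<^sup>2 * (\<sigma> t - \<tau> t)\<^sup>2 \<le> (d i)\<^sup>2 + 8 * K^3 * M / n" by linarith
      then show ?thesis using \<kappa> by (simp add: le_divide_eq mult.commute)
    qed
    have int: "set_integrable lborel {obs_time n (i - 1)..obs_time n i} (\<lambda>t. (\<sigma> t - \<tau> t)\<^sup>2)"
      by (intro borel_integrable_atLeastAtMost' continuous_on_subset[OF cont] obs_interval_subset i)
    have "(LINT t:{obs_time n (i - 1)..obs_time n i}|lborel. (\<sigma> t - \<tau> t)\<^sup>2)
        \<le> ((d i)\<^sup>2 + 8 * K^3 * M / n) / (4 * \<kappa>\<^sup>2) * (obs_time n i - obs_time n (i - 1))"
      by (rule set_integral_Icc_bounds(2)[OF int le, of 0]) (use pt in auto)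
    then have "4 * \<kappa>\<^sup>2 * (LINT t:{obs_time n (i - 1)..obs_time n i}|lborel. (\<sigma> t - \<tau> t)\<^sup>2)
        \<le> 4 * \<kappa>\<^sup>2 * (((d i)\<^sup>2 + 8 * K^3 * M / n) / (4 * \<kappa>\<^sup>2) * (1 / n))"
      unfolding obs_time_diff[OF 1] by (intro mult_left_mono) auto
    then show ?thesis using \<kappa> by simp
  qed
  have "4 * \<kappa>\<^sup>2 * (LINT t:{0..1}|lborel. (\<sigma> t - \<tau> t)\<^sup>2)
      = (\<Sum>i=1..n. 4 * \<kappa>\<^sup>2 * (LINT t:{obs_time n (i - 1)..obs_time n i}|lborel. (\<sigma> t - \<tau> t)\<^sup>2))"
    unfolding set_integral_obs_split[OF cont n] sum_distrib_left ..
  also have "\<dots> \<le> (\<Sum>i=1..n. ((d i)\<^sup>2 + 8 * K^3 * M / n) / n)"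
    by (intro sum_mono piece)
  also have "\<dots> = (\<Sum>i=1..n. (d i)\<^sup>2) / n + 8 * K^3 * M / n"
    using n by (simp add: add_divide_distrib sum.distrib sum_divide_distrib)
  finally show ?thesis unfolding d_def .
qed

section \<open>Divergence and noise in the likelihood ratio\<close>

text \<open>\<open>\<tau>\<close> takes the place of the true volatility and \<open>\<sigma>\<close>
  that of the competitor.\<close>

definition vratio :: "nat \<Rightarrow> (real \<Rightarrow> real) \<Rightarrow> (real \<Rightarrow> real) \<Rightarrow> nat \<Rightarrow> real" where
  "vratio n \<tau> \<sigma> i = increment_variance n \<tau> i / increment_variance n \<sigma> i"

text \<open>Factor by factor: with \<open>y / v = u + 1\<close> and
  \<open>y / w = r (u + 1)\<close>, the log ratio \<open>(ln r - y / w + y / v) / 2\<close> regroups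
  into a deterministic term in \<open>r\<close> and a term linear in \<open>u\<close>.\<close>

lemma likelihood_ratio:
  assumes \<sigma>: "\<sigma> \<in> \<X>" "\<tau> \<in> \<X>"
  shows "likelihood n x \<sigma> = likelihood n x \<tau> *
    exp (- ((\<Sum>i=1..n. vratio n \<tau> \<sigma> i - 1 - ln (vratio n \<tau> \<sigma> i))
      + (\<Sum>i=1..n. ((x i - x (i - 1))\<^sup>2 / increment_variance n \<tau> i - 1) * (vratio n \<tau> \<sigma> i - 1))) / 2)"
proof -
  define e where "e i = - ((vratio n \<tau> \<sigma> i - 1 - ln (vratio n \<tau> \<sigma> i))
      + ((x i - x (i - 1))\<^sup>2 / increment_variance n \<tau> i - 1) * (vratio n \<tau> \<sigma> i - 1)) / 2" for i
  define F where "F \<sigma> i = 1 / sqrt (2 * pi * increment_variance n \<sigma> i) *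
     \<psi> ((x i - x (i - 1)) / sqrt (increment_variance n \<sigma> i))" for \<sigma> i
  have F: "F \<sigma> i = F \<tau> i * exp (e i)" if i: "i \<in> {1..n}" for i
  proof -
    define v w y where "v = increment_variance n \<tau> i" and "w = increment_variance n \<sigma> i"
      and "y = (x i - x (i - 1))\<^sup>2"
    have pos: "0 < v" "0 < w" using increment_variance_bounds(3) \<sigma> i by (auto simp: v_def w_def)
    have "e i = ln (v / w) / 2 - y / w / 2 + y / v / 2"
      using pos unfolding e_def vratio_def v_def[symmetric] w_def[symmetric] y_def[symmetric]
      by (simp add: field_simps)
    then have "exp (e i) = exp (ln (v / w) / 2) * exp (- (y / w) / 2) / exp (- (y / v) / 2)"
      by (simp add: exp_diff[symmetric] exp_add[symmetric])
    also have "exp (ln (v / w) / 2) = sqrt v / sqrt w"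
      using pos by (simp add: ln_sqrt[symmetric] real_sqrt_divide)
    finally have "F \<tau> i * exp (e i) = 1 / sqrt (2 * pi * v) * exp (- (y / v) / 2) *
        (sqrt v / sqrt w * exp (- (y / w) / 2) / exp (- (y / v) / 2))"
      using pos by (simp only: F_def \<psi>_def power_divide v_def[symmetric] y_def[symmetric]
          real_sqrt_pow2 less_imp_le minus_divide_left)
    also have "\<dots> = 1 / sqrt (2 * pi * w) * exp (- (y / w) / 2)"
      using pos by (simp add: real_sqrt_mult)
    also have "\<dots> = F \<sigma> i"
      using pos by (simp only: F_def \<psi>_def power_divide w_def[symmetric] y_def[symmetric]
          real_sqrt_pow2 less_imp_le minus_divide_left)
    finally show ?thesis ..
  qed
  have "likelihood n x \<sigma> = (\<Prod>i=1..n. F \<tau> i * exp (e i))"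
    unfolding likelihood_def F_def[symmetric] using F by (intro prod.cong) auto
  also have "\<dots> = likelihood n x \<tau> * exp (\<Sum>i=1..n. e i)"
    unfolding likelihood_def F_def[symmetric] by (simp add: prod.distrib exp_sum)
  finally show ?thesis
    unfolding e_def sum_divide_distrib[symmetric] sum_negf sum.distrib .
qed

lemma vratio_alt:
  assumes "i \<in> {1..n}"
  shows "vratio n \<tau> \<sigma> i = (n * increment_variance n \<tau> i) / (n * increment_variance n \<sigma> i)"
  using assms by (simp add: vratio_def)

lemma vratio_bounds:
  assumes \<sigma>: "\<sigma> \<in> \<X>" "\<tau> \<in> \<X>" and i: "i \<in> {1..n}"
  shows "\<kappa>\<^sup>2 / K\<^sup>2 \<le> vratio n \<tau> \<sigma> i" "vratio n \<tau> \<sigma> i \<le> (K / \<kappa>)\<^sup>2" "0 < vratio n \<tau> \<sigma> i"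
proof -
  note b = increment_variance_bounds[OF \<sigma>(1) i] increment_variance_bounds[OF \<sigma>(2) i]
  have n: "0 < real n" using i by auto
  show "\<kappa>\<^sup>2 / K\<^sup>2 \<le> vratio n \<tau> \<sigma> i" "vratio n \<tau> \<sigma> i \<le> (K / \<kappa>)\<^sup>2"
    unfolding vratio_alt[OF i] power_divide using b \<kappa> n
    by (intro frac_le; simp)+
  show "0 < vratio n \<tau> \<sigma> i" unfolding vratio_def using b by simp
qed

text \<open>\<open>r - 1 - ln r\<close> is twice the Kullback-Leibler divergence between centred
  normal laws with variance ratio \<open>r\<close>. It dominates
  \<open>(r - 1)^2 / (K / \<kappa> + 1)^2\<close>, and \<open>r - 1\<close> is \<open>d i\<close>
  over an average of at most \<open>K^2\<close>, which gives the factor \<open>K^4\<close>;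
  \<open>L2_dist_le\<close> then leads to the L2 distance.\<close>

lemma divergence_ge:
  assumes \<sigma>: "\<sigma> \<in> \<X>" "\<tau> \<in> \<X>" and n: "0 < n"
  shows "(n * (4 * \<kappa>\<^sup>2 * (LINT t:{0..1}|lborel. (\<tau> t - \<sigma> t)\<^sup>2)) - 8 * K^3 * M) / (K^4 * (K / \<kappa> + 1)\<^sup>2)
    \<le> (\<Sum>i=1..n. vratio n \<tau> \<sigma> i - 1 - ln (vratio n \<tau> \<sigma> i))"
proof -
  define c where "c = K^4 * (K / \<kappa> + 1)\<^sup>2"
  have c: "0 < c" using \<kappa> by (auto simp: c_def intro!: mult_pos_pos zero_less_power add_pos_pos)
  define d where "d i = n * increment_variance n \<tau> i - n * increment_variance n \<sigma> i" for i
  have "n * (4 * \<kappa>\<^sup>2 * (LINT t:{0..1}|lborel. (\<tau> t - \<sigma> t)\<^sup>2))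
    \<le> n * ((\<Sum>i=1..n. (d i)\<^sup>2) / n + 8 * K^3 * M / n)"
    unfolding d_def by (intro mult_left_mono L2_dist_le \<sigma> n) auto
  also have "\<dots> = (\<Sum>i=1..n. (d i)\<^sup>2) + 8 * K^3 * M" using n by (simp add: field_simps)
  finally have "(n * (4 * \<kappa>\<^sup>2 * (LINT t:{0..1}|lborel. (\<tau> t - \<sigma> t)\<^sup>2)) - 8 * K^3 * M) / c
    \<le> (\<Sum>i=1..n. (d i)\<^sup>2) / c"
    using c by (intro divide_right_mono) auto
  also have "\<dots> = (\<Sum>i=1..n. (d i)\<^sup>2 / c)" by (simp add: sum_divide_distrib)
  also have "\<dots> \<le> (\<Sum>i=1..n. vratio n \<tau> \<sigma> i - 1 - ln (vratio n \<tau> \<sigma> i))"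
  proof (rule sum_mono)
    fix i assume i: "i \<in> {1..n}"
    define w where "w = n * increment_variance n \<sigma> i"
    have w: "0 < w" "w \<le> K\<^sup>2"
      using increment_variance_bounds[OF \<sigma>(1) i] n by (auto simp: w_def)
    have "(d i)\<^sup>2 / c = ((d i)\<^sup>2 / (K\<^sup>2)\<^sup>2) / (K / \<kappa> + 1)\<^sup>2" by (simp add: c_def)
    also have "\<dots> \<le> ((d i)\<^sup>2 / w\<^sup>2) / (K / \<kappa> + 1)\<^sup>2"
      using w \<kappa> by (intro divide_right_mono divide_left_mono power_mono) auto
    also have "(d i)\<^sup>2 / w\<^sup>2 = (vratio n \<tau> \<sigma> i - 1)\<^sup>2"
      unfolding vratio_alt[OF i] d_def w_def[symmetric] using w
      by (simp add: power_divide[symmetric] diff_divide_distrib)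
    also have "(vratio n \<tau> \<sigma> i - 1)\<^sup>2 / (K / \<kappa> + 1)\<^sup>2 \<le> vratio n \<tau> \<sigma> i - 1 - ln (vratio n \<tau> \<sigma> i)"
      using vratio_bounds[OF \<sigma> i] \<kappa> by (intro diff_ln_ge) auto
    finally show "(d i)\<^sup>2 / c \<le> vratio n \<tau> \<sigma> i - 1 - ln (vratio n \<tau> \<sigma> i)" .
  qed
  finally show ?thesis unfolding c_def .
qed

text \<open>The constant comes from \<open>\<bar>r - 1\<bar> \<le> 2 K \<delta> / \<kappa>^2\<close>
  and \<open>r \<ge> \<kappa>^2 / K^2\<close>, inserted into \<open>diff_ln_le\<close>.\<close>

lemma divergence_le:
  assumes \<sigma>: "\<sigma> \<in> \<X>" "\<tau> \<in> \<X>"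
    and close: "\<And>t. t \<in> {0..1} \<Longrightarrow> \<bar>\<tau> t - \<sigma> t\<bar> \<le> \<delta>"
  shows "(\<Sum>i=1..n. vratio n \<tau> \<sigma> i - 1 - ln (vratio n \<tau> \<sigma> i)) \<le> n * (4 * K^4 / \<kappa>^6 * \<delta>\<^sup>2)"
proof -
  have "vratio n \<tau> \<sigma> i - 1 - ln (vratio n \<tau> \<sigma> i) \<le> 4 * K^4 / \<kappa>^6 * \<delta>\<^sup>2" if i: "i \<in> {1..n}" for i
  proof -
    define v w r where "v = n * increment_variance n \<tau> i" and "w = n * increment_variance n \<sigma> i"
      and "r = vratio n \<tau> \<sigma> i"
    have w: "\<kappa>\<^sup>2 \<le> w" "0 < w"
      using increment_variance_bounds[OF \<sigma>(1) i] i by (auto simp: w_def)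
    have r: "\<kappa>\<^sup>2 / K\<^sup>2 \<le> r" "0 < r" using vratio_bounds[OF \<sigma> i] by (auto simp: r_def)
    have \<delta>: "0 \<le> \<delta>" using close[of 0] by auto
    have "\<bar>r - 1\<bar> = \<bar>v - w\<bar> / w"
      unfolding r_def vratio_alt[OF i] v_def[symmetric] w_def[symmetric] using w
      by (simp add: abs_div_pos diff_divide_distrib)
    also have "\<dots> \<le> (2 * K * \<delta>) / \<kappa>\<^sup>2"
      using increment_variance_close[OF \<sigma>(2,1) i close] w \<kappa> \<delta>
      unfolding v_def[symmetric] w_def[symmetric] by (intro frac_le) auto
    finally have "\<bar>r - 1\<bar>\<^sup>2 \<le> ((2 * K * \<delta>) / \<kappa>\<^sup>2)\<^sup>2" by (intro power_mono) auto
    then have "(r - 1)\<^sup>2 / r \<le> ((2 * K * \<delta>) / \<kappa>\<^sup>2)\<^sup>2 / (\<kappa>\<^sup>2 / K\<^sup>2)"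
      using r \<kappa> by (intro frac_le) auto
    also have "\<dots> = 4 * K^4 / \<kappa>^6 * \<delta>\<^sup>2"
      by (simp add: power_divide power_mult_distrib power2_eq_square eval_nat_numeral mult_ac)
    finally show ?thesis using diff_ln_le[OF r(2)] unfolding r_def by linarith
  qed
  then have "(\<Sum>i=1..n. vratio n \<tau> \<sigma> i - 1 - ln (vratio n \<tau> \<sigma> i)) \<le> (\<Sum>i=1..n. 4 * K^4 / \<kappa>^6 * \<delta>\<^sup>2)"
    by (intro sum_mono) auto
  then show ?thesis by simp
qed

text \<open>Adjacent intervals share the time \<open>obs_time n m\<close>, so both averages lie
  within \<open>2 K M / n\<close> of the same value. The rest is the quotient rule for differences,
  with denominators bounded below through \<open>\<kappa>\<close>.\<close>

lemma vratio_step: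
  assumes \<sigma>: "\<sigma> \<in> \<X>" "\<tau> \<in> \<X>" and m: "0 < m" "m < n"
  shows "\<bar>vratio n \<tau> \<sigma> (Suc m) - vratio n \<tau> \<sigma> m\<bar> \<le> 4 * K * M * (1 / \<kappa>\<^sup>2 + K\<^sup>2 / \<kappa>^4) / n"
proof -
  have i: "m \<in> {1..n}" "Suc m \<in> {1..n}" using m by auto
  define v v' w w' where "v = n * increment_variance n \<tau> m" and "v' = n * increment_variance n \<tau> (Suc m)"
    and "w = n * increment_variance n \<sigma> m" and "w' = n * increment_variance n \<sigma> (Suc m)"
  have b: "\<kappa>\<^sup>2 \<le> v" "v \<le> K\<^sup>2" "\<kappa>\<^sup>2 \<le> w" "\<kappa>\<^sup>2 \<le> w'"
    using increment_variance_bounds[OF \<sigma>(1) i(1)] increment_variance_bounds[OF \<sigma>(1) i(2)]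
      increment_variance_bounds[OF \<sigma>(2) i(1)] by (auto simp: v_def w_def w'_def)
  have \<kappa>2: "0 < \<kappa>\<^sup>2" using \<kappa> by simp
  have pos: "0 < v" "0 < w" "0 < w'" using b \<kappa>2 by linarith+
  have step: "\<bar>n * increment_variance n \<rho> (Suc m) - n * increment_variance n \<rho> m\<bar> \<le> 4 * K * M / n"
    if \<rho>: "\<rho> \<in> \<X>" for \<rho>
  proof -
    have "obs_time n m \<in> {obs_time n (m - 1)..obs_time n m}"
      "obs_time n m \<in> {obs_time n (Suc m - 1)..obs_time n (Suc m)}"
      by (auto intro!: obs_time_le)
    from increment_variance_approx[OF \<rho> i(1) this(1)] increment_variance_approx[OF \<rho> i(2) this(2)]
    show ?thesis by (simp add: abs_le_iff)
  qed
  have sv: "\<bar>v' - v\<bar> \<le> 4 * K * M / n" and sw: "\<bar>w - w'\<bar> \<le> 4 * K * M / n"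
    using step[OF \<sigma>(2)] step[OF \<sigma>(1)] by (auto simp: v_def v'_def w_def w'_def abs_minus_commute)
  have c0: "0 \<le> 4 * K * M / n" using \<kappa> M by simp
  have "vratio n \<tau> \<sigma> (Suc m) - vratio n \<tau> \<sigma> m = (v' - v) / w' + v * (w - w') / (w * w')"
    unfolding vratio_alt[OF i(1)] vratio_alt[OF i(2)] v_def[symmetric] v'_def[symmetric]
      w_def[symmetric] w'_def[symmetric] using pos by (simp add: field_simps)
  also have "\<bar>\<dots>\<bar> \<le> \<bar>v' - v\<bar> / w' + v * \<bar>w - w'\<bar> / (w * w')"
    using pos by (intro order_trans[OF abs_triangle_ineq]) (simp add: abs_mult)
  also have "\<dots> \<le> (4 * K * M / n) / \<kappa>\<^sup>2 + K\<^sup>2 * (4 * K * M / n) / (\<kappa>\<^sup>2 * \<kappa>\<^sup>2)"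
  proof (intro add_mono)
    show "\<bar>v' - v\<bar> / w' \<le> (4 * K * M / n) / \<kappa>\<^sup>2"
      using c0 sv \<kappa>2 b(4) by (intro frac_le)
    have "v * \<bar>w - w'\<bar> \<le> K\<^sup>2 * (4 * K * M / n)"
      using b(2) sw by (intro mult_mono) auto
    moreover have "\<kappa>\<^sup>2 * \<kappa>\<^sup>2 \<le> w * w'"
      using b(3,4) pos by (intro mult_mono) auto
    ultimately show "v * \<bar>w - w'\<bar> / (w * w') \<le> K\<^sup>2 * (4 * K * M / n) / (\<kappa>\<^sup>2 * \<kappa>\<^sup>2)"
      using c0 \<kappa>2 by (intro frac_le mult_nonneg_nonneg mult_pos_pos) auto
  qed
  also have "\<dots> = 4 * K * M * (1 / \<kappa>\<^sup>2 + K\<^sup>2 / \<kappa>^4) / n"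
    by (simp add: add_divide_distrib distrib_left power_add[symmetric] mult_ac)
  finally show ?thesis .
qed

text \<open>The right-hand side is free of \<open>\<sigma>\<close>, so numerator and denominator of
  the posterior can be controlled on one event. \<open>C\<close> adds the bound for the last
  coefficient and the one for the steps, so that a single constant serves both.\<close>

lemma noise_le:
  assumes \<sigma>: "\<sigma> \<in> \<X>" "\<tau> \<in> \<X>"
  defines "C \<equiv> (K / \<kappa>)\<^sup>2 + 1 + 4 * K * M * (1 / \<kappa>\<^sup>2 + K\<^sup>2 / \<kappa>^4)"
  shows "\<bar>\<Sum>i=1..n. u i * (vratio n \<tau> \<sigma> i - 1)\<bar>
    \<le> C * (\<bar>\<Sum>i=1..n. u i\<bar> + (\<Sum>m<n. \<bar>\<Sum>i=1..m. u i\<bar>) / n)"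
proof (rule abs_sum_by_parts_le)
  have pos: "0 \<le> 4 * K * M * (1 / \<kappa>\<^sup>2 + K\<^sup>2 / \<kappa>^4)" using \<kappa> M by simp
  assume "0 < n"
  then have "n \<in> {1..n}" by simp
  from vratio_bounds[OF \<sigma> this] pos show "\<bar>vratio n \<tau> \<sigma> n - 1\<bar> \<le> C"
    unfolding C_def by linarith
next
  fix m assume m: "0 < m" "m < n"
  have "4 * K * M * (1 / \<kappa>\<^sup>2 + K\<^sup>2 / \<kappa>^4) \<le> C" by (simp add: C_def)
  then have "4 * K * M * (1 / \<kappa>\<^sup>2 + K\<^sup>2 / \<kappa>^4) / n \<le> C / n" by (intro divide_right_mono) auto
  with vratio_step[OF \<sigma> m] show "\<bar>vratio n \<tau> \<sigma> (Suc m) - 1 - (vratio n \<tau> \<sigma> m - 1)\<bar> \<le> C / n"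
    by simp
qed

end

section \<open>The posterior\<close>

lemma sets_borel_of_topology: "sets (borel_of_topology T) = sigma_sets (topspace T) {U. openin T U}"
  unfolding borel_of_topology_def by (intro sets_measure_of) (auto dest: openin_subset)

lemma space_borel_of_topology [simp]: "space (borel_of_topology T) = topspace T"
  unfolding borel_of_topology_def by (intro space_measure_of) (auto dest: openin_subset)

lemma space_lipschitz_borel [simp]: "space (lipschitz_borel \<kappa> K M) = lipschitz_class \<kappa> K M"
  by (simp add: lipschitz_borel_def)

lemma borel_measurable_norm_topology:
  fixes f :: "(real \<Rightarrow> real) \<Rightarrow> real"
  assumes "\<And>\<sigma> e. \<lbrakk>\<sigma> \<in> S; 0 < e\<rbrakk> \<Longrightarrow>
    \<exists>d>0. \<forall>\<tau>\<in>S. N (\<lambda>t. \<tau> t - \<sigma> t) < d \<longrightarrow> \<bar>f \<tau> - f \<sigma>\<bar> < e"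
  shows "f \<in> borel_measurable (borel_of_topology (norm_topology S N))"
proof (rule borel_measurableI)
  fix V :: "real set" assume V: "open V"
  have "openin (norm_topology S N) (f -` V \<inter> S)"
    unfolding openin_norm_topology
  proof (intro conjI ballI)
    fix \<sigma> assume \<sigma>: "\<sigma> \<in> f -` V \<inter> S"
    then obtain e where e: "0 < e" "\<And>y. \<bar>y - f \<sigma>\<bar> < e \<Longrightarrow> y \<in> V"
      using V unfolding open_dist dist_real_def by blast
    obtain d where "0 < d" "\<forall>\<tau>\<in>S. N (\<lambda>t. \<tau> t - \<sigma> t) < d \<longrightarrow> \<bar>f \<tau> - f \<sigma>\<bar> < e"
      using assms[of \<sigma> e] \<sigma> e(1) by auto
    then show "\<exists>\<epsilon>>0. {\<sigma>' \<in> S. N (\<lambda>t. \<sigma>' t - \<sigma> t) < \<epsilon>} \<subseteq> f -` V \<inter> S"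
      using e(2) by (intro exI[of _ d]) auto
  qed auto
  then show "f -` V \<inter> space (borel_of_topology (norm_topology S N)) \<in> sets (borel_of_topology (norm_topology S N))"
    by (auto simp: sets_borel_of_topology)
qed

text \<open>In the numerator the bound on \<open>A\<close> meets a total mass of 1; in the
  denominator nonnegativity allows restriction to \<open>B\<close>.\<close>

lemma posterior_le:
  assumes "prob_space prior" and A: "A \<in> sets prior" and B: "B \<in> sets prior" "0 < measure prior B"
    and int: "integrable prior (likelihood n x)"
    and nonneg: "\<And>\<sigma>. \<sigma> \<in> space prior \<Longrightarrow> 0 \<le> likelihood n x \<sigma>"
    and a: "\<And>\<sigma>. \<sigma> \<in> A \<Longrightarrow> likelihood n x \<sigma> \<le> a" and "0 \<le> a"
    and b: "\<And>\<sigma>. \<sigma> \<in> B \<Longrightarrow> b \<le> likelihood n x \<sigma>" and "0 < b"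
  shows "posterior prior n x A \<le> a / (b * measure prior B)"
proof -
  interpret prob_space prior by fact
  have "(LINT \<sigma>:A|prior. likelihood n x \<sigma>) \<le> (LINT \<sigma>|prior. a)"
    unfolding set_lebesgue_integral_def
    using A int a \<open>0 \<le> a\<close> 
    by (intro integral_mono integrable_mult_indicator) (auto simp: indicator_def)
  then have num: "(LINT \<sigma>:A|prior. likelihood n x \<sigma>) \<le> a" by (simp add: prob_space)
  have "integrable prior (\<lambda>\<sigma>. b * indicat_real B \<sigma>)"
    using B(1) by (intro integrable_mult_right integrable_real_indicator) (auto simp: less_top[symmetric])
  then have "(LINT \<sigma>|prior. b * indicator B \<sigma>) \<le> (LINT \<sigma>|prior. likelihood n x \<sigma>)"
    using int b nonneg by (intro integral_mono) (auto simp: indicator_def)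
  then have den: "b * prob B \<le> (LINT \<sigma>|prior. likelihood n x \<sigma>)" using B(1) by simp
  show ?thesis
    unfolding posterior_def
    by (intro frac_le num den mult_pos_pos B \<open>0 < b\<close> \<open>0 \<le> a\<close>)
qed

section \<open>Measurability and integrability of the likelihood\<close>

context lipschitz_bounds
begin

lemma sup_norm_bound:
  assumes "\<sigma> \<in> \<X>" "\<tau> \<in> \<X>" "t \<in> {0..1}"
  shows "\<bar>\<sigma> t - \<tau> t\<bar> \<le> sup_norm (\<lambda>t. \<sigma> t - \<tau> t)"
  unfolding sup_norm_def
proof (rule cSUP_upper[OF assms(3)], rule bdd_aboveI2)
  fix s :: real assume "s \<in> {0..1}"
  then show "\<bar>\<sigma> s - \<tau> s\<bar> \<le> K"
    using class_bounds[OF assms(1), of s] class_bounds[OF assms(2), of s] by linarith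
qed

text \<open>The volatility enters the likelihood only through these finitely many variances. Each is
  Lipschitz in the sup norm with constant \<open>2 K / n\<close>, which explains
  \<open>d\<close>.\<close>

lemma borel_measurable_increment_variance:
  assumes i: "i \<in> {1..n}"
  shows "(\<lambda>\<sigma>. increment_variance n \<sigma> i) \<in> borel_measurable (lipschitz_borel \<kappa> K M)"
  unfolding lipschitz_borel_def
proof (rule borel_measurable_norm_topology)
  fix \<sigma> and e :: real assume \<sigma>: "\<sigma> \<in> \<X>" and e: "0 < e"
  have n: "0 < real n" using i by auto
  have K: "0 < K" using \<kappa> by simp
  define d where "d = n * e / (2 * K)"
  have "\<bar>increment_variance n \<tau> i - increment_variance n \<sigma> i\<bar> < e"
    if \<tau>: "\<tau> \<in> \<X>" and lt: "sup_norm (\<lambda>t. \<tau> t - \<sigma> t) < d" for \<tau>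
  proof -
    have "n * \<bar>increment_variance n \<tau> i - increment_variance n \<sigma> i\<bar>
        = \<bar>n * increment_variance n \<tau> i - n * increment_variance n \<sigma> i\<bar>"
      using n by (simp add: right_diff_distrib[symmetric] abs_mult)
    also have "\<dots> \<le> 2 * K * sup_norm (\<lambda>t. \<tau> t - \<sigma> t)"
      by (rule increment_variance_close[OF \<tau> \<sigma> i sup_norm_bound[OF \<tau> \<sigma>]])
    also have "\<dots> < 2 * K * d" using lt K by (intro mult_strict_left_mono) auto
    also have "\<dots> = n * e" using K by (simp add: d_def)
    finally show ?thesis using n by simp
  qed
  moreover have "0 < d" using n e K by (simp add: d_def)
  ultimately show "\<exists>d>0. \<forall>\<tau>\<in>\<X>. sup_norm (\<lambda>t. \<tau> t - \<sigma> t) < d \<longrightarrow>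
      \<bar>increment_variance n \<tau> i - increment_variance n \<sigma> i\<bar> < e" by blast
qed

text \<open>Links the closed intervals of the likelihood with the half-open ones of the Wiener
  increments, which differ by a null set.\<close>

lemma increment_variance_Ioc:
  assumes \<sigma>: "\<sigma> \<in> \<X>" and i: "i \<in> {1..n}"
  shows "(LINT u:{obs_time n (i - 1)<..obs_time n i}|lborel. (\<sigma> u)\<^sup>2) = increment_variance n \<sigma> i"
  unfolding increment_variance_def
proof (rule set_integral_cong_set)
  note int = class_set_integrable[OF \<sigma> i]
  show "set_borel_measurable lborel {obs_time n (i - 1)..obs_time n i} (\<lambda>u. (\<sigma> u)\<^sup>2)"
    using int by (auto simp: set_integrable_def set_borel_measurable_def)
  have "{obs_time n (i - 1)<..obs_time n i} \<subseteq> {obs_time n (i - 1)..obs_time n i}" by auto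
  from set_integrable_subset[OF int _ this]
  show "set_borel_measurable lborel {obs_time n (i - 1)<..obs_time n i} (\<lambda>u. (\<sigma> u)\<^sup>2)"
    by (auto simp: set_integrable_def set_borel_measurable_def)
  show "AE u in lborel. u \<in> {obs_time n (i - 1)..obs_time n i} \<longleftrightarrow> u \<in> {obs_time n (i - 1)<..obs_time n i}"
    using AE_lborel_singleton[of "obs_time n (i - 1)"] by eventually_elim auto
qed

lemma likelihood_pos:
  assumes "\<sigma> \<in> \<X>"
  shows "0 < likelihood n x \<sigma>"
  unfolding likelihood_def using increment_variance_bounds(3)[OF assms]
  by (intro prod_pos) (simp add: \<psi>_def)

text \<open>Gives integrability against the prior for fixed data, from \<open>\<psi> \<le> 1\<close>
  and variances of at least \<open>\<kappa>^2 / n\<close>.\<close>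

lemma likelihood_bounded:
  assumes "\<sigma> \<in> \<X>"
  shows "likelihood n x \<sigma> \<le> (1 / sqrt (2 * pi * (\<kappa>\<^sup>2 / n))) ^ n"
proof -
  have "likelihood n x \<sigma> \<le> (\<Prod>i=1..n. 1 / sqrt (2 * pi * (\<kappa>\<^sup>2 / n)))"
    unfolding likelihood_def
  proof (rule prod_mono)
    fix i assume i: "i \<in> {1..n}"
    then have n: "0 < real n" by auto
    note b = increment_variance_bounds[OF assms i]
    have le: "\<kappa>\<^sup>2 / n \<le> increment_variance n \<sigma> i" using b(1) n by (simp add: field_simps)
    have "1 / sqrt (2 * pi * increment_variance n \<sigma> i) *
          \<psi> ((x i - x (i - 1)) / sqrt (increment_variance n \<sigma> i))
      \<le> 1 / sqrt (2 * pi * (\<kappa>\<^sup>2 / n)) * 1"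
    proof (intro mult_mono frac_le real_sqrt_le_mono mult_left_mono le)
      show "0 < sqrt (2 * pi * (\<kappa>\<^sup>2 / n))" using n \<kappa> by simp
    qed (auto simp: \<psi>_def)
    then show "0 \<le> 1 / sqrt (2 * pi * increment_variance n \<sigma> i) *
          \<psi> ((x i - x (i - 1)) / sqrt (increment_variance n \<sigma> i)) \<and>
        1 / sqrt (2 * pi * increment_variance n \<sigma> i) *
          \<psi> ((x i - x (i - 1)) / sqrt (increment_variance n \<sigma> i))
      \<le> 1 / sqrt (2 * pi * (\<kappa>\<^sup>2 / n))"
      using b(3) by (simp add: \<psi>_def)
  qed
  then show ?thesis by simp
qed

text \<open>Data and volatility both depend on \<open>z\<close>: with \<open>s = snd\<close> on a
  product this is joint measurability, with constant data and \<open>s\<close> the identity it is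
  measurability in the volatility.\<close>

lemma borel_measurable_likelihood:
  assumes "sets prior = sets (lipschitz_borel \<kappa> K M)"
    and x: "\<And>i. i \<le> n \<Longrightarrow> x i \<in> borel_measurable N"
    and s: "s \<in> measurable N prior"
  shows "(\<lambda>z. likelihood n (\<lambda>i. x i z) (s z)) \<in> borel_measurable N"
proof -
  have v: "(\<lambda>z. increment_variance n (s z) i) \<in> borel_measurable N" if "i \<in> {1..n}" for i
    using measurable_compose[OF s, of "\<lambda>\<sigma>. increment_variance n \<sigma> i" borel]
      borel_measurable_increment_variance[OF that] measurable_cong_sets[OF assms(1) refl] by auto
  show ?thesis
    unfolding likelihood_def \<psi>_def
  proof (rule borel_measurable_prod)
    fix i assume i: "i \<in> {1..n}"
    have [measurable]: "(\<lambda>z. increment_variance n (s z) i) \<in> borel_measurable N" by (rule v[OF i])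
    have [measurable]: "x i \<in> borel_measurable N" "x (i - 1) \<in> borel_measurable N"
      using i by (auto intro!: x)
    show "(\<lambda>z. 1 / sqrt (2 * pi * increment_variance n (s z) i) *
        exp (- ((x i z - x (i - 1) z) / sqrt (increment_variance n (s z) i))\<^sup>2 / 2)) \<in> borel_measurable N"
      by measurable
  qed
qed

text \<open>Joint measurability allows the volatility to be integrated out, which leaves numerator
  and denominator measurable in the path.\<close>

lemma borel_measurable_posterior:
  assumes "prob_space prior" and sets: "sets prior = sets (lipschitz_borel \<kappa> K M)" and A: "A \<in> sets prior"
  shows "(\<lambda>x. posterior prior n (\<lambda>i. x (obs_time n i)) A) \<in> borel_measurable (Pi\<^sub>M {0..1} (\<lambda>_. borel))"
proof -
  interpret prob_space prior by fact
  let ?N = "Pi\<^sub>M {0..1} (\<lambda>_. borel) \<Otimes>\<^sub>M prior"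
  have [measurable]: "(\<lambda>z. likelihood n (\<lambda>i. fst z (obs_time n i)) (snd z)) \<in> borel_measurable ?N"
    by (rule borel_measurable_likelihood[OF sets])
      (auto intro!: measurable_compose[OF measurable_fst] measurable_component_singleton obs_time_in)
  have [measurable]: "A \<in> sets prior" by fact
  have 1: "(\<lambda>(x, \<sigma>). likelihood n (\<lambda>i. x (obs_time n i)) \<sigma>) \<in> borel_measurable ?N"
    unfolding split_beta by measurable
  have 2: "(\<lambda>(x, \<sigma>). indicator A \<sigma> *\<^sub>R likelihood n (\<lambda>i. x (obs_time n i)) \<sigma>) \<in> borel_measurable ?N"
    unfolding split_beta by measurable
  show ?thesis
    unfolding posterior_def set_lebesgue_integral_def
    using borel_measurable_lebesgue_integral[OF 1] borel_measurable_lebesgue_integral[OF 2]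
    by (rule borel_measurable_divide[rotated])
qed

section \<open>Posterior bound and consistency\<close>

text \<open>No randomness is left here: the noise bound is a condition on the data \<open>x\<close>.
  The common factor \<open>likelihood n x \<sigma>\<^sub>0\<close> cancels, and the noise is paid
  for in both integrals, hence \<open>2 * C * \<eta>\<close>.\<close>

lemma posterior_bound:
  fixes x :: "nat \<Rightarrow> real" and \<eta> :: real
  assumes prior: "prob_space prior" "sets prior = sets (lipschitz_borel \<kappa> K M)"
    and A: "A \<in> sets prior" and n: "0 < n"
    and \<sigma>\<^sub>0: "\<sigma>\<^sub>0 \<in> \<X>"
    and e: "\<And>\<sigma>. \<sigma> \<in> A \<Longrightarrow> e\<^sup>2 \<le> (LINT t:{0..1}|lborel. (\<sigma>\<^sub>0 t - \<sigma> t)\<^sup>2)"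
    and B: "0 < measure prior {\<sigma>\<in>\<X>. sup_norm (\<lambda>t. \<sigma> t - \<sigma>\<^sub>0 t) < \<delta>}"
  defines "a \<equiv> 4 * \<kappa>\<^sup>2 * e\<^sup>2 / (K^4 * (K / \<kappa> + 1)\<^sup>2)"
    and "b \<equiv> 8 * K^3 * M / (K^4 * (K / \<kappa> + 1)\<^sup>2)"
    and "C \<equiv> (K / \<kappa>)\<^sup>2 + 1 + 4 * K * M * (1 / \<kappa>\<^sup>2 + K\<^sup>2 / \<kappa>^4)"
    and "u \<equiv> (\<lambda>i. (x i - x (i - 1))\<^sup>2 / increment_variance n \<sigma>\<^sub>0 i - 1)"
  assumes noise: "\<bar>\<Sum>i=1..n. u i\<bar> + (\<Sum>m<n. \<bar>\<Sum>i=1..m. u i\<bar>) / n \<le> \<eta> * n"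
  shows "posterior prior n x A
    \<le> exp ((b - n * (a - 4 * K^4 / \<kappa>^6 * \<delta>\<^sup>2 - 2 * C * \<eta>)) / 2)
      / measure prior {\<sigma>\<in>\<X>. sup_norm (\<lambda>t. \<sigma> t - \<sigma>\<^sub>0 t) < \<delta>}"
proof -
  interpret prob_space prior by fact
  have space: "space prior = \<X>" using sets_eq_imp_space_eq[OF prior(2)] by simp
  define B where "B = {\<sigma>\<in>\<X>. sup_norm (\<lambda>t. \<sigma> t - \<sigma>\<^sub>0 t) < \<delta>}"
  define c where "c = K^4 * (K / \<kappa> + 1)\<^sup>2"
  have c: "0 < c" using \<kappa> by (auto simp: c_def intro!: mult_pos_pos zero_less_power add_pos_pos)
  \<comment> \<open>\<open>measure\<close> is 0 on sets outside the sigma-algebra, so positive prior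
    mass already yields measurability of the ball.\<close>
  have Bs: "B \<in> sets prior" using B measure_notin_sets[of B prior] by (auto simp: B_def)
  have C0: "0 \<le> C" using \<kappa> M by (simp add: C_def)
  define g where "g \<sigma> = (\<Sum>i=1..n. vratio n \<sigma>\<^sub>0 \<sigma> i - 1 - ln (vratio n \<sigma>\<^sub>0 \<sigma> i))" for \<sigma>
  define h where "h \<sigma> = (\<Sum>i=1..n. u i * (vratio n \<sigma>\<^sub>0 \<sigma> i - 1))" for \<sigma>
  have L: "likelihood n x \<sigma> = likelihood n x \<sigma>\<^sub>0 * exp (- (g \<sigma> + h \<sigma>) / 2)" if "\<sigma> \<in> \<X>" for \<sigma>
    using likelihood_ratio[OF that \<sigma>\<^sub>0] by (simp add: g_def h_def u_def)
  have h: "\<bar>h \<sigma>\<bar> \<le> C * (\<eta> * n)" if "\<sigma> \<in> \<X>" for \<sigma>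
    unfolding h_def using noise_le[OF that \<sigma>\<^sub>0, of u n] mult_left_mono[OF noise C0]
    unfolding C_def by linarith
  have L0: "0 < likelihood n x \<sigma>\<^sub>0" by (rule likelihood_pos[OF \<sigma>\<^sub>0])
  \<comment> \<open>\<open>\<alpha>\<close> bounds \<open>g + h\<close> from below on
    \<open>A\<close>, \<open>\<beta>\<close> bounds it from above on \<open>B\<close>; the exponent
    in the claim is \<open>(\<beta> - \<alpha>) / 2\<close>.\<close>
  define \<alpha> where "\<alpha> = n * a - b - C * (\<eta> * n)"
  define \<beta> where "\<beta> = n * (4 * K^4 / \<kappa>^6 * \<delta>\<^sup>2) + C * (\<eta> * n)"
  have "posterior prior n x A \<le> (likelihood n x \<sigma>\<^sub>0 * exp (- \<alpha> / 2)) / ((likelihood n x \<sigma>\<^sub>0 * exp (- \<beta> / 2)) * prob B)"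
  proof (rule posterior_le[OF prior(1) A Bs])
    have "likelihood n x \<in> borel_measurable prior"
      using borel_measurable_likelihood[OF prior(2), of n "\<lambda>i _. x i" prior "\<lambda>z. z"] by simp
    moreover have "norm (likelihood n x \<sigma>) \<le> (1 / sqrt (2 * pi * (\<kappa>\<^sup>2 / n))) ^ n" if "\<sigma> \<in> space prior" for \<sigma>
      using likelihood_bounded[of \<sigma> n x] likelihood_pos[of \<sigma> n x] that by (simp add: space)
    ultimately show "integrable prior (likelihood n x)"
      by (intro integrable_const_bound[of _ "(1 / sqrt (2 * pi * (\<kappa>\<^sup>2 / n))) ^ n"] AE_I2)
    show "0 \<le> likelihood n x \<sigma>" if "\<sigma> \<in> space prior" for \<sigma>
      using likelihood_pos[of \<sigma> n x] that by (simp add: space)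
    show "likelihood n x \<sigma> \<le> likelihood n x \<sigma>\<^sub>0 * exp (- \<alpha> / 2)" if "\<sigma> \<in> A" for \<sigma>
    proof -
      have \<sigma>: "\<sigma> \<in> \<X>" using sets.sets_into_space[OF A] that by (auto simp: space)
      have "n * a - b = (n * (4 * \<kappa>\<^sup>2 * e\<^sup>2) - 8 * K^3 * M) / c"
        by (simp add: a_def b_def c_def diff_divide_distrib)
      also have "\<dots> \<le> (n * (4 * \<kappa>\<^sup>2 * (LINT t:{0..1}|lborel. (\<sigma>\<^sub>0 t - \<sigma> t)\<^sup>2)) - 8 * K^3 * M) / c"
        using c e[OF that] by (intro divide_right_mono diff_right_mono mult_left_mono) auto
      also have "\<dots> \<le> g \<sigma>"
        unfolding c_def g_def by (rule divergence_ge[OF \<sigma> \<sigma>\<^sub>0 n])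
      finally have "\<alpha> \<le> g \<sigma> + h \<sigma>" using h[OF \<sigma>] by (simp add: \<alpha>_def abs_le_iff)
      then show ?thesis unfolding L[OF \<sigma>] using L0 by simp
    qed
    show "likelihood n x \<sigma>\<^sub>0 * exp (- \<beta> / 2) \<le> likelihood n x \<sigma>" if "\<sigma> \<in> B" for \<sigma>
    proof -
      have \<sigma>: "\<sigma> \<in> \<X>" "sup_norm (\<lambda>t. \<sigma> t - \<sigma>\<^sub>0 t) < \<delta>" using that by (auto simp: B_def)
      have "g \<sigma> \<le> n * (4 * K^4 / \<kappa>^6 * \<delta>\<^sup>2)"
        unfolding g_def
      proof (rule divergence_le[OF \<sigma>(1) \<sigma>\<^sub>0])
        fix t :: real assume "t \<in> {0..1}"
        from sup_norm_bound[OF \<sigma>(1) \<sigma>\<^sub>0 this] \<sigma>(2) show "\<bar>\<sigma>\<^sub>0 t - \<sigma> t\<bar> \<le> \<delta>"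
          by (simp add: abs_minus_commute)
      qed
      then have "g \<sigma> + h \<sigma> \<le> \<beta>" using h[OF \<sigma>(1)] by (simp add: \<beta>_def abs_le_iff)
      then show ?thesis unfolding L[OF \<sigma>(1)] using L0 by simp
    qed
  qed (use L0 B in \<open>auto simp: B_def\<close>)
  also have "\<dots> = (exp (- \<alpha> / 2) / exp (- \<beta> / 2)) / prob B" using L0 by simp
  also have "exp (- \<alpha> / 2) / exp (- \<beta> / 2) = exp (- \<alpha> / 2 + \<beta> / 2)"
    by (simp add: exp_diff[symmetric])
  also have "- \<alpha> / 2 + \<beta> / 2 = (b - n * (a - 4 * K^4 / \<kappa>^6 * \<delta>\<^sup>2 - 2 * C * \<eta>)) / 2"
    by (simp add: \<alpha>_def \<beta>_def field_simps)
  finally show ?thesis unfolding B_def .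
qed

end

text \<open>Dividing by the variances of the very volatility that generates \<open>X\<close> is what
  makes the \<open>u i\<close> centred and orthogonal.\<close>

lemma (in lipschitz_bounds) noise_tail:
  fixes \<eta> :: real
  assumes bm: "standard_brownian_motion \<Omega> W"
    and X: "\<forall>t\<in>{0..1}. has_wiener_integral \<Omega> W \<sigma> t (X t)"
    and \<sigma>: "\<sigma> \<in> \<X>" and n: "0 < n" and \<eta>: "0 < \<eta>"
  defines "u \<equiv> (\<lambda>i \<omega>. (X (obs_time n i) \<omega> - X (obs_time n (i - 1)) \<omega>)\<^sup>2 / increment_variance n \<sigma> i - 1)"
  shows "measure \<Omega> {\<omega>\<in>space \<Omega>. \<eta> * n \<le> \<bar>\<Sum>i=1..n. u i \<omega>\<bar> + (\<Sum>m<n. \<bar>\<Sum>i=1..m. u i \<omega>\<bar>) / n}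
    \<le> 3 / (\<eta> * sqrt n)"
proof -
  interpret prob_space \<Omega> using bm by (simp add: standard_brownian_motion_def)
  have int: "set_integrable lborel {0..1} (\<lambda>u. (\<sigma> u)\<^sup>2)"
    by (intro borel_integrable_atLeastAtMost' continuous_on_power class_continuous \<sigma>)
  have p: "is_partition 0 1 n (obs_time n)"
    using n by (auto simp: is_partition_def obs_time_def divide_right_mono)
  have pos: "0 < (LINT u:{obs_time n (i - 1)<..obs_time n i}|lborel. (\<sigma> u)\<^sup>2)" if "i \<in> {1..n}" for i
    unfolding increment_variance_Ioc[OF \<sigma> that] by (rule increment_variance_bounds(3)[OF \<sigma> that])
  show ?thesis
  proof (rule partial_sums_tail[OF _ _ n \<eta>])
    fix i assume i: "i \<in> {1..n}"
    have [measurable]: "X (obs_time n i) \<in> borel_measurable \<Omega>" "X (obs_time n (i - 1)) \<in> borel_measurable \<Omega>"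
      using X i obs_time_in[of i n] obs_time_in[of "i - 1" n] by (auto simp: has_wiener_integral_def)
    show "u i \<in> borel_measurable \<Omega>" unfolding u_def by measurable
    fix j assume j: "j \<in> {1..n}"
    show "has_bochner_integral \<Omega> (\<lambda>\<omega>. u i \<omega> * u j \<omega>) (if i = j then 2 else 0)"
      using wiener_squares_uncorrelated[OF bm X int p pos i j]
      unfolding increment_variance_Ioc[OF \<sigma> i] increment_variance_Ioc[OF \<sigma> j] u_def by simp
  qed
qed

theorem theorem1:
  fixes \<kappa> K M :: real
    and prior :: "(real \<Rightarrow> real) measure"
    and \<sigma>\<^sub>0 :: "real \<Rightarrow> real" and U :: "(real \<Rightarrow> real) set"
    and \<Omega> :: "'w measure" and W X :: "real \<Rightarrow> 'w \<Rightarrow> real"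
  assumes "0 < \<kappa>" "\<kappa> < K" "0 < M"
    and "prob_space prior" "sets prior = sets (lipschitz_borel \<kappa> K M)"
    and "\<forall>\<epsilon>>0. \<forall>\<sigma>\<in>lipschitz_class \<kappa> K M.
           measure prior {\<sigma>'\<in>lipschitz_class \<kappa> K M. sup_norm (\<lambda>t. \<sigma>' t - \<sigma> t) < \<epsilon>} > 0"
    and "\<sigma>\<^sub>0 \<in> lipschitz_class \<kappa> K M"
    and "U \<in> sets (lipschitz_borel \<kappa> K M)"
    and "\<exists>V. openin (norm_topology (lipschitz_class \<kappa> K M) L2_norm) V \<and> \<sigma>\<^sub>0 \<in> V \<and> V \<subseteq> U"
    and "standard_brownian_motion \<Omega> W"
    and "\<forall>t\<in>{0..1}. has_wiener_integral \<Omega> W \<sigma>\<^sub>0 t (X t)"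
  shows "converges_in_probability (path_law \<Omega> X)
           (\<lambda>n x. posterior prior n (\<lambda>i. x (obs_time n i)) (lipschitz_class \<kappa> K M - U)) (\<lambda>_. 0)"
proof -
  interpret lipschitz_bounds \<kappa> K M by standard (use assms(1-3) in auto)
  interpret prior: prob_space prior by fact
  interpret \<Omega>: prob_space \<Omega> using assms(10) by (simp add: standard_brownian_motion_def)
  note sets = assms(5) and \<sigma>\<^sub>0 = assms(7) and bm = assms(10) and X = assms(11)
  have space: "space prior = \<X>" using sets_eq_imp_space_eq[OF sets] by simp
  define A where "A = \<X> - U"
  have A: "A \<in> sets prior"
    using sets.compl_sets[of U "lipschitz_borel \<kappa> K M"] assms(8) sets by (simp add: A_def)
  let ?P = "Pi\<^sub>M {0..1} (\<lambda>_. borel) :: (real \<Rightarrow> real) measure"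
  let ?post = "\<lambda>n x. posterior prior n (\<lambda>i. x (obs_time n i)) A"
  have path: "(\<lambda>\<omega>. \<lambda>t\<in>{0..1}. X t \<omega>) \<in> measurable \<Omega> ?P"
    using X by (intro measurable_restrict) (auto simp: has_wiener_integral_def)
  have post[measurable]: "?post n \<in> borel_measurable ?P" for n
    by (rule borel_measurable_posterior[OF assms(4) sets A])
  \<comment> \<open>Allows the absolute value in the definition of convergence to be
    dropped.\<close>
  have post0: "0 \<le> ?post n x" for n x
    unfolding posterior_def set_lebesgue_integral_def
  proof (intro divide_nonneg_nonneg integral_nonneg_AE AE_I2)
    fix \<sigma> assume "\<sigma> \<in> space prior"
    then have "0 \<le> likelihood n (\<lambda>i. x (obs_time n i)) \<sigma>"
      using likelihood_pos by (simp add: space less_imp_le)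
    then show "0 \<le> indicat_real A \<sigma> *\<^sub>R likelihood n (\<lambda>i. x (obs_time n i)) \<sigma>"
      "0 \<le> likelihood n (\<lambda>i. x (obs_time n i)) \<sigma>" by simp_all
  qed
  obtain e where e: "0 < e" "{\<sigma>\<in>\<X>. L2_norm (\<lambda>t. \<sigma> t - \<sigma>\<^sub>0 t) < e} \<subseteq> U"
    using assms(9) unfolding openin_norm_topology by blast
  have far: "e\<^sup>2 \<le> (LINT t:{0..1}|lborel. (\<sigma>\<^sub>0 t - \<sigma> t)\<^sup>2)" if "\<sigma> \<in> A" for \<sigma>
  proof -
    have "e \<le> L2_norm (\<lambda>t. \<sigma> t - \<sigma>\<^sub>0 t)" using e(2) that by (force simp: A_def)
    then have "e \<le> sqrt (LINT t:{0..1}|lborel. (\<sigma>\<^sub>0 t - \<sigma> t)\<^sup>2)"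
      by (simp add: L2_norm_def power2_commute)
    then have "e\<^sup>2 \<le> (sqrt (LINT t:{0..1}|lborel. (\<sigma>\<^sub>0 t - \<sigma> t)\<^sup>2))\<^sup>2"
      using e(1) by (intro power_mono) auto
    also have "\<dots> = (LINT t:{0..1}|lborel. (\<sigma>\<^sub>0 t - \<sigma> t)\<^sup>2)"
      unfolding set_lebesgue_integral_def by (intro real_sqrt_pow2 Bochner_Integration.integral_nonneg) simp
    finally show ?thesis .
  qed
  define a where "a = 4 * \<kappa>\<^sup>2 * e\<^sup>2 / (K^4 * (K / \<kappa> + 1)\<^sup>2)"
  define b where "b = 8 * K^3 * M / (K^4 * (K / \<kappa> + 1)\<^sup>2)"
  define C where "C = (K / \<kappa>)\<^sup>2 + 1 + 4 * K * M * (1 / \<kappa>\<^sup>2 + K\<^sup>2 / \<kappa>^4)"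
  have a: "0 < a"
    using \<kappa> e(1) unfolding a_def
    by (intro divide_pos_pos mult_pos_pos zero_less_power add_pos_pos) auto
  have C: "0 < C" using \<kappa> M unfolding C_def by (intro add_nonneg_pos add_pos_nonneg) auto
  \<comment> \<open>Of the rate \<open>a\<close>, a quarter is spent on the divergence inside the
    prior ball (through \<open>\<delta>\<close>) and a quarter on the noise in both integrals
    (through \<open>\<eta>\<close>), which leaves \<open>a / 2\<close>.\<close>
  define \<delta> where "\<delta> = sqrt (a / 4 / (4 * K^4 / \<kappa>^6))"
  have c: "0 < 4 * K^4 / \<kappa>^6" using \<kappa> by simp
  have \<delta>: "0 < \<delta>" "4 * K^4 / \<kappa>^6 * \<delta>\<^sup>2 = a / 4"
    using a c \<kappa> by (auto simp: \<delta>_def)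
  define \<eta> where "\<eta> = a / (8 * C)"
  have \<eta>: "0 < \<eta>" "2 * C * \<eta> = a / 4" using a C by (auto simp: \<eta>_def)
  define \<pi> where "\<pi> = measure prior {\<sigma>\<in>\<X>. sup_norm (\<lambda>t. \<sigma> t - \<sigma>\<^sub>0 t) < \<delta>}"
  have \<pi>: "0 < \<pi>" using assms(6) \<sigma>\<^sub>0 \<delta>(1) by (simp add: \<pi>_def)
  have tail: "(\<lambda>n. measure (path_law \<Omega> X) {x\<in>space (path_law \<Omega> X). \<bar>?post n x - 0\<bar> > \<epsilon>}) \<longlonglongrightarrow> 0"
    if \<epsilon>: "0 < \<epsilon>" for \<epsilon>
  proof (rule tendsto_sandwich[OF _ _ tendsto_const])
    \<comment> \<open>Once the exponential bound is below \<open>\<epsilon>\<close>, a posterior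
      mass above \<open>\<epsilon>\<close> forces the noise to reach \<open>\<eta> n\<close>, an
      event of probability O(1 / sqrt n).\<close>
    have "(\<lambda>n. exp ((b - real n * (a / 2)) / 2) / \<pi>) \<longlonglongrightarrow> 0"
      using a \<pi> by real_asymp
    then have "eventually (\<lambda>n. exp ((b - real n * (a / 2)) / 2) / \<pi> < \<epsilon>) sequentially"
      using \<epsilon> by (rule order_tendstoD)
    then show "eventually (\<lambda>n. measure (path_law \<Omega> X) {x\<in>space (path_law \<Omega> X). \<bar>?post n x - 0\<bar> > \<epsilon>}
        \<le> 3 / (\<eta> * sqrt n)) sequentially"
      using eventually_gt_at_top[of 0]
    proof eventually_elim
      case (elim n)
      define u where "u i \<omega> = (X (obs_time n i) \<omega> - X (obs_time n (i - 1)) \<omega>)\<^sup>2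
        / increment_variance n \<sigma>\<^sub>0 i - 1" for i \<omega>
      define T where "T \<omega> = \<bar>\<Sum>i=1..n. u i \<omega>\<bar> + (\<Sum>m<n. \<bar>\<Sum>i=1..m. u i \<omega>\<bar>) / n" for \<omega>
      have "{x\<in>space ?P. \<bar>?post n x - 0\<bar> > \<epsilon>} \<in> sets ?P" by measurable
      then have "measure (path_law \<Omega> X) {x\<in>space (path_law \<Omega> X). \<bar>?post n x - 0\<bar> > \<epsilon>}
        = measure \<Omega> ((\<lambda>\<omega>. \<lambda>t\<in>{0..1}. X t \<omega>) -` {x\<in>space ?P. \<bar>?post n x - 0\<bar> > \<epsilon>} \<inter> space \<Omega>)"
        unfolding path_law_def using path by (simp add: measure_distr)
      also have "\<dots> \<le> measure \<Omega> {\<omega>\<in>space \<Omega>. \<eta> * n \<le> T \<omega>}"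
      proof (rule \<Omega>.finite_measure_mono)
        show "{\<omega>\<in>space \<Omega>. \<eta> * n \<le> T \<omega>} \<in> sets \<Omega>"
        proof -
          have [measurable]: "u i \<in> borel_measurable \<Omega>" if "i \<le> n" for i
          proof -
            have [measurable]: "X (obs_time n i) \<in> borel_measurable \<Omega>" "X (obs_time n (i - 1)) \<in> borel_measurable \<Omega>"
              using X that obs_time_in[of i n] obs_time_in[of "i - 1" n] by (auto simp: has_wiener_integral_def)
            show ?thesis unfolding u_def by measurable
          qed
          have [measurable]: "(\<lambda>\<omega>. \<Sum>i=1..m. u i \<omega>) \<in> borel_measurable \<Omega>" if "m \<le> n" for m
            using that by (intro borel_measurable_sum) auto
          have [measurable]: "T \<in> borel_measurable \<Omega>" unfolding T_def by measurable
          show ?thesis by measurable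
        qed
        show "(\<lambda>\<omega>. \<lambda>t\<in>{0..1}. X t \<omega>) -` {x\<in>space ?P. \<bar>?post n x - 0\<bar> > \<epsilon>} \<inter> space \<Omega>
          \<subseteq> {\<omega>\<in>space \<Omega>. \<eta> * n \<le> T \<omega>}"
        proof (intro subsetI CollectI conjI)
          fix \<omega> assume \<omega>: "\<omega> \<in> (\<lambda>\<omega>. \<lambda>t\<in>{0..1}. X t \<omega>) -` {x\<in>space ?P. \<bar>?post n x - 0\<bar> > \<epsilon>} \<inter> space \<Omega>"
          then show "\<omega> \<in> space \<Omega>" by simp
          \<comment> \<open>Elements of the path space are restricted functions; observation times
            lie in \<open>[0,1]\<close>, so the restriction does not alter the observed
            values.\<close>
          define y where "y = (\<lambda>i. (\<lambda>t\<in>{0..1}. X t \<omega>) (obs_time n i))"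
          have y: "(y i - y (i - 1))\<^sup>2 / increment_variance n \<sigma>\<^sub>0 i - 1 = u i \<omega>" if "i \<le> n" for i
            using that obs_time_in[of i n] obs_time_in[of "i - 1" n] by (simp add: y_def u_def)
          have T: "T \<omega> = \<bar>\<Sum>i=1..n. (y i - y (i - 1))\<^sup>2 / increment_variance n \<sigma>\<^sub>0 i - 1\<bar>
            + (\<Sum>m<n. \<bar>\<Sum>i=1..m. (y i - y (i - 1))\<^sup>2 / increment_variance n \<sigma>\<^sub>0 i - 1\<bar>) / n"
            unfolding T_def using y by simp
          show "\<eta> * n \<le> T \<omega>"
          proof (rule ccontr)
            assume "\<not> \<eta> * n \<le> T \<omega>"
            then have "T \<omega> \<le> \<eta> * n" by simp
            from posterior_bound[OF assms(4) sets A elim(2) \<sigma>\<^sub>0 far \<pi>[unfolded \<pi>_def] this[unfolded T]]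
            have "posterior prior n y A \<le> exp ((b - n * (a - a / 4 - a / 4)) / 2) / \<pi>"
              unfolding a_def[symmetric] b_def[symmetric] C_def[symmetric] \<delta>(2) \<eta>(2) \<pi>_def[symmetric] by simp
            also have "a - a / 4 - a / 4 = a / 2" by simp
            finally have "posterior prior n y A < \<epsilon>" using elim(1) by simp
            then show False using \<omega> post0[of n "\<lambda>t\<in>{0..1}. X t \<omega>"] by (simp add: y_def)
          qed
        qed
      qed
      also have "\<dots> \<le> 3 / (\<eta> * sqrt n)"
        unfolding T_def u_def by (rule noise_tail[OF bm X \<sigma>\<^sub>0 elim(2) \<eta>(1)])
      finally show ?case .
    qed
    show "(\<lambda>n. 3 / (\<eta> * sqrt (real n))) \<longlonglongrightarrow> 0" using \<eta>(1) by real_asymp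
  qed simp
  have "?post n \<in> borel_measurable (path_law \<Omega> X)" for n
    using post by (simp add: path_law_def)
  then show ?thesis
    unfolding converges_in_probability_def A_def[symmetric] using tail by simp
qed

end
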